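(* Let $\mathfrak{a}>0$, $\gamma\ge 0$ and $\nu\in(-2,0]$, and set $$a(x)=\mathfrak{a}x^\gamma \quad (x>0),\qquad b(x,y)=(\nu+2)\frac{x^\nu}{y^{\nu+1}}\quad (0<x<y).$$ Then there is a unique stationary solution $f_{\gamma,\nu}$ to $$-f''(x)+a(x)f(x)=\int_x^\infty a(y)b(x,y)f(y)\,\mathrm{d}y,\quad x\in(0,\infty),\qquad f(0)=0,$$ such that $\int_0^\infty x f_{\gamma,\nu}(x)\,\mathrm{d}x=1$. It is given by $$f_{\gamma,\nu}(z)=c_{\gamma,\nu}\sqrt{\mathfrak{a}}\,z^{(\nu+3)/2}K_{|\nu+1|/(\gamma+2)}\left(\frac{2\sqrt{\mathfrak{a}}}{\gamma+2}z^{(\gamma+2)/2}\right),\qquad z\in(0,\infty),$$ where $c_{\gamma,\nu}$ is a scaling parameter guaranteeing that $\int_0^\infty x f_{\gamma,\nu}(x)\,\mathrm{d}x=1$, and $K_\rho$ denotes the modified Bessel function of the second kind with parameter $\rho\ge 0$.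
   Context: For $m\in\mathbb{R}$, $X_m:=L_1((0,\infty),x^m\mathrm{d}x)$. A (stationary) solution means a nonnegative function $f\in C([0,\infty))\cap C^\infty((0,\infty))$ satisfying the equation on $(0,\infty)$ and the boundary condition $f(0)=0$, with $f\in\bigcap_{m>-1}X_m$, $af\in\bigcap_{m>-1}X_m$, $f''\in\bigcap_{m\ge1}X_m$, and $\lim_{z\to\infty}f(z)=\lim_{z\to\infty}zf'(z)=0$. *)

theory Defs
  imports "HOL-Probability.Probability" "HOL-Real_Asymp.Real_Asymp"
begin

section \<open>Stationary solutions\<close>

definition frag_rate :: "real \<Rightarrow> real \<Rightarrow> real \<Rightarrow> real" where
  "frag_rate A \<gamma> x = A * x powr \<gamma>"

text \<open>Only the values for \<open>0 < x < y\<close> are meaningful.\<close>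

definition frag_kernel :: "real \<Rightarrow> real \<Rightarrow> real \<Rightarrow> real" where
  "frag_kernel \<nu> x y = (\<nu> + 2) * x powr \<nu> / y powr (\<nu> + 1)"

text \<open>Membership in the weighted space of functions integrable for \<open>x powr m dx\<close> on the half-line.\<close>

definition in_X :: "real \<Rightarrow> (real \<Rightarrow> real) \<Rightarrow> bool" where
  "in_X m f \<longleftrightarrow> set_integrable lborel {0<..} (\<lambda>x. x powr m * f x)"

text \<open>
  The solution is a function on the closed half-line; values at negative arguments play no role.
  Differentiability of all iterated derivatives is smoothness on the open half-line.
\<close>

definition stationary_solution ::
  "(real \<Rightarrow> real) \<Rightarrow> (real \<Rightarrow> real \<Rightarrow> real) \<Rightarrow> (real \<Rightarrow> real) \<Rightarrow> bool" where
  "stationary_solution a b f \<longleftrightarrow>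
     (\<forall>x\<ge>0. 0 \<le> f x) \<and>
     continuous_on {0..} f \<and>
     (\<forall>n. \<forall>x>0. ((deriv ^^ n) f) field_differentiable (at x)) \<and>
     (\<forall>x>0. - (deriv ^^ 2) f x + a x * f x = (LBINT y:{x<..}. a y * b x y * f y)) \<and>
     f 0 = 0 \<and>
     (\<forall>m>-1. in_X m f) \<and>
     (\<forall>m>-1. in_X m (\<lambda>x. a x * f x)) \<and>
     (\<forall>m\<ge>1. in_X m ((deriv ^^ 2) f)) \<and>
     (f \<longlongrightarrow> 0) at_top \<and>
     ((\<lambda>z. z * deriv f z) \<longlongrightarrow> 0) at_top"


section \<open>The modified Bessel function of the second kind\<close>

text \<open>
  For a positive real argument, the second modified Bessel function is the solution of the modified
  Bessel equation that is asymptotic to \<open>sqrt (pi / (2 * x)) * exp (- x)\<close> at infinity. It is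
  introduced here by its integral representation on the positive half-line; the lemmas
  \<open>bessel_K_ode\<close> and \<open>bessel_K_asymp\<close> below establish the two characteristic properties.
\<close>

definition bessel_K :: "real \<Rightarrow> real \<Rightarrow> real" where
  "bessel_K \<rho> x = (LBINT t:{0<..}. exp (- x * cosh t) * cosh (\<rho> * t))"

definition bessel_moment :: "real \<Rightarrow> nat \<Rightarrow> real \<Rightarrow> real" where
  "bessel_moment \<rho> k x = (LBINT t:{0<..}. exp (- x * cosh t) * cosh (\<rho> * t) * cosh t ^ k)"

lemma cosh_le_exp_abs: "cosh (t::real) \<le> exp \<bar>t\<bar>"
proof -
  have "exp t \<le> exp \<bar>t\<bar>" "exp (- t) \<le> exp \<bar>t\<bar>" by (simp_all del: exp_le_cancel_iff add: exp_le_cancel_iff[THEN iffD2])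
  hence "exp t + exp (- t) \<le> 2 * exp \<bar>t\<bar>" by (simp del: exp_le_cancel_iff)
  thus ?thesis by (simp add: cosh_field_def)
qed

lemma abs_sinh_le_exp_abs: "\<bar>sinh (t::real)\<bar> \<le> exp \<bar>t\<bar>"
proof -
  have "\<bar>sinh t\<bar> \<le> cosh t"
    using sinh_less_cosh_real[of t] sinh_less_cosh_real[of "- t"] by (simp add: abs_le_iff)
  thus ?thesis using cosh_le_exp_abs[of t] by linarith
qed

lemma cosh_ge_quadratic: "1 + t\<^sup>2 / 2 \<le> cosh (t::real)"
proof -
  have le_sinh: "s \<le> sinh s" if "s \<ge> 0" for s :: real
  proof -
    have "(\<lambda>x. sinh x - x) 0 \<le> (\<lambda>x. sinh x - x) s"
      by (rule DERIV_nonneg_imp_nondecreasing[OF that])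
         (auto intro!: derivative_eq_intros exI simp: cosh_real_ge_1)
    thus ?thesis by simp
  qed
  have nonneg: "1 + s\<^sup>2 / 2 \<le> cosh s" if "s \<ge> 0" for s :: real
  proof -
    have "(\<lambda>x. cosh x - x\<^sup>2 / 2) 0 \<le> (\<lambda>x. cosh x - x\<^sup>2 / 2) s"
    proof (rule DERIV_nonneg_imp_nondecreasing[OF that])
      fix u :: real assume u: "0 \<le> u" "u \<le> s"
      have "((\<lambda>x. cosh x - x\<^sup>2 / 2) has_real_derivative (sinh u - u)) (at u)"
        by (auto intro!: derivative_eq_intros)
      thus "\<exists>y. ((\<lambda>x. cosh x - x\<^sup>2 / 2) has_real_derivative y) (at u) \<and> 0 \<le> y"
        using le_sinh[of u] u by auto
    qed
    thus ?thesis by simp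
  qed
  show ?thesis using nonneg[of "\<bar>t\<bar>"] by simp
qed

lemma integrable_gaussian_exp:
  assumes "x > (0::real)"
  shows "integrable lborel (\<lambda>t. exp (- x * t\<^sup>2 / 2 + M * t))"
proof -
  define \<sigma> where "\<sigma> = 1 / sqrt x"
  have \<sigma>: "\<sigma> > 0" "\<sigma>\<^sup>2 = 1 / x" using assms by (auto simp: \<sigma>_def power_divide)
  have "integrable lborel (\<lambda>t. exp (M\<^sup>2 / (2 * x)) * sqrt (2 * pi * \<sigma>\<^sup>2) * normal_density (M / x) \<sigma> t)"
    by (intro integrable_mult_right integrable_normal_density \<sigma>)
  also have "(\<lambda>t. exp (M\<^sup>2 / (2 * x)) * sqrt (2 * pi * \<sigma>\<^sup>2) * normal_density (M / x) \<sigma> t)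
      = (\<lambda>t. exp (- x * t\<^sup>2 / 2 + M * t))"
  proof
    fix t
    have "M\<^sup>2 / (2 * x) + - (t - M / x)\<^sup>2 / (2 * \<sigma>\<^sup>2) = - x * t\<^sup>2 / 2 + M * t"
      unfolding \<sigma>(2) using assms by (simp add: field_simps power2_eq_square)
    thus "exp (M\<^sup>2 / (2 * x)) * sqrt (2 * pi * \<sigma>\<^sup>2) * normal_density (M / x) \<sigma> t = exp (- x * t\<^sup>2 / 2 + M * t)"
      unfolding normal_density_def using \<sigma>(1) by (simp add: exp_add [symmetric])
  qed
  finally show ?thesis .
qed

lemma bessel_integrand_bound:
  assumes "x > 0" "t \<ge> (0::real)"
  shows "exp (- x * cosh t) * cosh (\<rho> * t) * cosh t ^ k \<le> exp (- x * t\<^sup>2 / 2 + (\<bar>\<rho>\<bar> + real k) * t)"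
proof -
  have "x * (t\<^sup>2 / 2) \<le> x * cosh t"
    using cosh_ge_quadratic[of t] assms by (intro mult_left_mono) auto
  hence "- x * cosh t \<le> - x * t\<^sup>2 / 2" by simp
  hence "exp (- x * cosh t) \<le> exp (- x * t\<^sup>2 / 2)" by simp
  moreover have "cosh (\<rho> * t) \<le> exp (\<bar>\<rho>\<bar> * t)"
    using cosh_le_exp_abs[of "\<rho> * t"] assms by (simp add: abs_mult)
  moreover have "cosh t ^ k \<le> exp (real k * t)"
    using power_mono[OF cosh_le_exp_abs[of t], of k] assms by (simp add: exp_of_nat_mult)
  ultimately have "exp (- x * cosh t) * cosh (\<rho> * t) * cosh t ^ k
      \<le> exp (- x * t\<^sup>2 / 2) * exp (\<bar>\<rho>\<bar> * t) * exp (real k * t)"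
    by (intro mult_mono) auto
  thus ?thesis by (simp add: exp_add [symmetric] algebra_simps)
qed

lemma bessel_integrand_integrable:
  assumes "x > (0::real)"
  shows "set_integrable lborel {0<..} (\<lambda>t::real. exp (- x * cosh t) * cosh (\<rho> * t) * cosh t ^ k)"
  unfolding set_integrable_def
proof (rule Bochner_Integration.integrable_bound)
  show "integrable lborel (\<lambda>t. exp (- x * t\<^sup>2 / 2 + (\<bar>\<rho>\<bar> + real k) * t))"
    by (rule integrable_gaussian_exp[OF assms])
  have [measurable]: "(\<lambda>t. exp (- x * cosh t) * cosh (\<rho> * t) * cosh t ^ k) \<in> borel_measurable borel"
    by (intro borel_measurable_continuous_onI continuous_intros)
  show "(\<lambda>t. indicator {0<..} t *\<^sub>R (exp (- x * cosh t) * cosh (\<rho> * t) * cosh t ^ k)) \<in> borel_measurable lborel"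
    by measurable
  show "AE t in lborel. norm (indicator {0<..} t *\<^sub>R (exp (- x * cosh t) * cosh (\<rho> * t) * cosh t ^ k))
      \<le> norm (exp (- x * t\<^sup>2 / 2 + (\<bar>\<rho>\<bar> + real k) * t))"
    using bessel_integrand_bound[OF assms, of _ \<rho> k] by (auto simp: indicator_def)
qed

lemma exp_quotient_bound:
  assumes "(c::real) \<ge> 0" "h \<noteq> 0"
  shows "\<bar>(exp (- h * c) - 1) / h\<bar> \<le> c * exp (\<bar>h\<bar> * c)"
proof -
  have "\<bar>exp u - 1\<bar> \<le> \<bar>u\<bar> * exp \<bar>u\<bar>" for u :: real
  proof (cases "u \<ge> 0")
    case True
    have "1 - u \<le> exp (- u)" using exp_ge_add_one_self[of "- u"] by simp
    hence "exp u * (1 - u) \<le> exp u * exp (- u)" by (intro mult_left_mono) auto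
    hence "exp u - 1 \<le> u * exp u" by (simp add: exp_minus algebra_simps)
    thus ?thesis using True by simp
  next
    case False
    have 1: "1 - exp u \<le> - u" using exp_ge_add_one_self[of u] by linarith
    have "(- u) * 1 \<le> (- u) * exp (- u)" using False by (intro mult_left_mono) auto
    with 1 have "1 - exp u \<le> (- u) * exp (- u)" by linarith
    moreover have "exp u \<le> 1" using False by simp
    ultimately show ?thesis using False by simp
  qed
  from this[of "- h * c"] show ?thesis
    using assms by (simp add: abs_mult field_simps)
qed

lemma DERIV_bessel_moment:
  assumes "x > 0"
  shows "(bessel_moment \<rho> k has_real_derivative - bessel_moment \<rho> (Suc k) x) (at x)"
  unfolding DERIV_def
proof (subst tendsto_at_iff_sequentially, intro allI impI)
  define g where "g = (\<lambda>t. cosh (\<rho> * t) * cosh t ^ k :: real)"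
  have g0: "g t \<ge> 0" for t by (simp add: g_def)
  have [measurable]: "g \<in> borel_measurable borel"
    unfolding g_def by (intro borel_measurable_continuous_onI continuous_intros)
  have [measurable]: "(cosh :: real \<Rightarrow> real) \<in> borel_measurable borel"
    by (intro borel_measurable_continuous_onI continuous_intros)
  fix X :: "nat \<Rightarrow> real" assume X: "\<forall>i. X i \<in> UNIV - {0}" and lim: "X \<longlonglongrightarrow> 0"
  have "eventually (\<lambda>n. \<bar>X n\<bar> < x / 2) sequentially"
    using tendsto_rabs[OF lim] assms by (intro order_tendstoD(2)[where y = 0]) auto
  then obtain N where N: "\<And>n. n \<ge> N \<Longrightarrow> \<bar>X n\<bar> < x / 2"
    by (auto simp: eventually_sequentially)
  define Y where "Y n = X (n + N)" for n
  have Y: "\<bar>Y n\<bar> < x / 2" "Y n \<noteq> 0" for n using N[of "n + N"] X by (auto simp: Y_def)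
  have limY: "Y \<longlonglongrightarrow> 0" unfolding Y_def by (rule LIMSEQ_ignore_initial_segment[OF lim])
  define D where "D n t = indicator {0<..} t *\<^sub>R ((exp (- Y n * cosh t) - 1) / Y n * exp (- x * cosh t) * g t)" for n t
  have quot: "(bessel_moment \<rho> k (x + Y n) - bessel_moment \<rho> k x) / Y n = (LBINT t. D n t)" for n
  proof -
    have "x + Y n > 0" using Y(1)[of n] assms by (auto simp: abs_if split: if_splits)
    hence I: "set_integrable lborel {0<..} (\<lambda>t. exp (- (x + Y n) * cosh t) * cosh (\<rho> * t) * cosh t ^ k)"
      by (rule bessel_integrand_integrable)
    have "(bessel_moment \<rho> k (x + Y n) - bessel_moment \<rho> k x) / Y n =
       (LBINT t:{0<..}. (exp (- (x + Y n) * cosh t) * cosh (\<rho> * t) * cosh t ^ k -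
            exp (- x * cosh t) * cosh (\<rho> * t) * cosh t ^ k) / Y n)"
      unfolding bessel_moment_def
      by (subst set_integral_diff(2)[symmetric, OF I bessel_integrand_integrable[OF assms]])
         (simp only: set_integral_divide_zero)
    also have "\<dots> = (LBINT t. D n t)"
      unfolding set_lebesgue_integral_def D_def g_def
      by (intro Bochner_Integration.integral_cong)
         (auto simp: algebra_simps exp_add diff_divide_distrib add_divide_distrib simp flip: exp_add)
    finally show ?thesis .
  qed
  have "(\<lambda>n. LBINT t. D n t) \<longlonglongrightarrow>
      (LBINT t. indicator {0<..} t *\<^sub>R (- cosh t * exp (- x * cosh t) * g t))"
  proof (rule integral_dominated_convergence)
    show "(\<lambda>t. indicator {0<..} t *\<^sub>R (- cosh t * exp (- x * cosh t) * g t)) \<in> borel_measurable lborel"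
      by measurable
    show "D n \<in> borel_measurable lborel" for n unfolding D_def by measurable
    show "integrable lborel (\<lambda>t. indicator {0<..} t *\<^sub>R
         (exp (- (x/2) * cosh t) * cosh (\<rho> * t) * cosh t ^ Suc k))"
      using bessel_integrand_integrable[of "x/2" \<rho> "Suc k"] assms unfolding set_integrable_def by simp
    show "AE t in lborel. (\<lambda>n. D n t) \<longlonglongrightarrow> indicator {0<..} t *\<^sub>R (- cosh t * exp (- x * cosh t) * g t)"
    proof (rule AE_I2)
      fix t :: real
      have "((\<lambda>h. exp (- h * cosh t)) has_real_derivative - cosh t) (at 0)"
        by (auto intro!: derivative_eq_intros)
      hence "((\<lambda>h. (exp (- h * cosh t) - 1) / h) \<longlongrightarrow> - cosh t) (at 0)"
        by (simp add: DERIV_def)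
      moreover have "filterlim Y (at 0) sequentially"
        using limY Y(2) by (simp add: filterlim_at)
      ultimately have "(\<lambda>n. (exp (- Y n * cosh t) - 1) / Y n) \<longlonglongrightarrow> - cosh t"
        by (rule filterlim_compose)
      thus "(\<lambda>n. D n t) \<longlonglongrightarrow> indicator {0<..} t *\<^sub>R (- cosh t * exp (- x * cosh t) * g t)"
        unfolding D_def by (intro tendsto_intros)
    qed
    show "AE t in lborel. norm (D n t) \<le> indicator {0<..} t *\<^sub>R
         (exp (- (x/2) * cosh t) * cosh (\<rho> * t) * cosh t ^ Suc k)" for n
    proof (rule AE_I2)
      fix t :: real
      have "\<bar>(exp (- Y n * cosh t) - 1) / Y n\<bar> * exp (- x * cosh t) \<le>
          (cosh t * exp (\<bar>Y n\<bar> * cosh t)) * exp (- x * cosh t)"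
        using exp_quotient_bound[of "cosh t" "Y n"] Y(2)[of n] by (intro mult_right_mono) auto
      also have "\<dots> = cosh t * exp ((\<bar>Y n\<bar> - x) * cosh t)"
        by (simp add: algebra_simps flip: exp_add)
      also have "\<dots> \<le> cosh t * exp (- (x / 2) * cosh t)"
      proof -
        have "(\<bar>Y n\<bar> - x) * cosh t \<le> - (x / 2) * cosh t"
          using Y(1)[of n] by (intro mult_right_mono) auto
        thus ?thesis by (intro mult_left_mono) auto
      qed
      finally have "\<bar>(exp (- Y n * cosh t) - 1) / Y n\<bar> * exp (- x * cosh t) * g t
          \<le> cosh t * exp (- (x / 2) * cosh t) * g t"
        by (intro mult_right_mono g0)
      thus "norm (D n t) \<le> indicator {0<..} t *\<^sub>R
         (exp (- (x/2) * cosh t) * cosh (\<rho> * t) * cosh t ^ Suc k)"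
        using g0[of t] by (auto simp: D_def indicator_def abs_mult g_def mult_ac)
    qed
  qed
  also have "(LBINT t. indicator {0<..} t *\<^sub>R (- cosh t * exp (- x * cosh t) * g t)) = - bessel_moment \<rho> (Suc k) x"
    unfolding bessel_moment_def set_lebesgue_integral_def g_def
    by (subst Bochner_Integration.integral_minus[symmetric], intro Bochner_Integration.integral_cong) (auto simp: mult_ac)
  finally have "(\<lambda>n. (bessel_moment \<rho> k (x + Y n) - bessel_moment \<rho> k x) / Y n)
     \<longlonglongrightarrow> - bessel_moment \<rho> (Suc k) x"
    by (simp add: quot)
  hence "(\<lambda>n. (\<lambda>h. (bessel_moment \<rho> k (x + h) - bessel_moment \<rho> k x) / h) (X (n + N)))
     \<longlonglongrightarrow> - bessel_moment \<rho> (Suc k) x" by (simp add: Y_def)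
  hence "(\<lambda>n. (\<lambda>h. (bessel_moment \<rho> k (x + h) - bessel_moment \<rho> k x) / h) (X n))
     \<longlonglongrightarrow> - bessel_moment \<rho> (Suc k) x" by (rule LIMSEQ_offset)
  thus "((\<lambda>h. (bessel_moment \<rho> k (x + h) - bessel_moment \<rho> k x) / h) \<circ> X)
     \<longlonglongrightarrow> - bessel_moment \<rho> (Suc k) x" by (simp add: o_def)
qed

lemma bessel_K_eq_moment: "bessel_K \<rho> = bessel_moment \<rho> 0"
  by (simp add: bessel_K_def bessel_moment_def fun_eq_iff)

lemma bessel_moment_recurrence:
  assumes x: "x > 0"
  shows "x\<^sup>2 * bessel_moment \<rho> 2 x - x * bessel_moment \<rho> 1 x - (x\<^sup>2 + \<rho>\<^sup>2) * bessel_moment \<rho> 0 x = 0"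
proof -
  define E where "E k t = exp (- x * cosh t) * cosh (\<rho> * t) * cosh t ^ k" for k t
  define F where "F t = - exp (- x * cosh t) * (x * sinh t * cosh (\<rho> * t) + \<rho> * sinh (\<rho> * t))" for t
  define f where "f t = x\<^sup>2 * E 2 t - x * E 1 t - (x\<^sup>2 + \<rho>\<^sup>2) * E 0 t" for t
  have I: "set_integrable lborel {0<..} (\<lambda>t. E k t)" for k
    unfolding E_def by (rule bessel_integrand_integrable[OF x])
  have If: "set_integrable lborel {0<..} f"
    unfolding f_def by (intro set_integral_diff set_integrable_mult_right I)
  have "(LBINT t=0..\<infinity>. f t) = 0 - 0"
  proof (rule interval_integral_FTC_integrable)
    fix t :: real
    have "(F has_real_derivative f t) (at t)"
      unfolding F_def
    proof (rule DERIV_cong)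
      show "((\<lambda>t. - exp (- x * cosh t) * (x * sinh t * cosh (\<rho> * t) + \<rho> * sinh (\<rho> * t))) has_real_derivative
         (x * sinh t * exp (- x * cosh t)) * (x * sinh t * cosh (\<rho> * t) + \<rho> * sinh (\<rho> * t))
         - exp (- x * cosh t) * (x * (cosh t * cosh (\<rho> * t) + \<rho> * sinh t * sinh (\<rho> * t)) + \<rho> * (\<rho> * cosh (\<rho> * t)))) (at t)"
        by (auto intro!: derivative_eq_intros simp: algebra_simps)
      have c: "cosh t * cosh t = 1 + sinh t * sinh t"
        using hyperbolic_pythagoras[of t] by (simp add: power2_eq_square)
      show "(x * sinh t * exp (- x * cosh t)) * (x * sinh t * cosh (\<rho> * t) + \<rho> * sinh (\<rho> * t))
         - exp (- x * cosh t) * (x * (cosh t * cosh (\<rho> * t) + \<rho> * sinh t * sinh (\<rho> * t)) + \<rho> * (\<rho> * cosh (\<rho> * t))) = f t"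
        unfolding f_def E_def power2_eq_square c by (simp add: algebra_simps)
    qed
    thus "(F has_vector_derivative f t) (at t)"
      by (simp add: has_real_derivative_iff_has_vector_derivative)
    show "isCont f t" unfolding f_def E_def by (intro continuous_intros)
  next
    have "isCont F 0" unfolding F_def by (intro continuous_intros)
    hence "(F \<longlongrightarrow> F 0) (at_right 0)" by (simp add: isCont_def filterlim_at_split)
    moreover have "F 0 = 0" by (simp add: F_def)
    ultimately show "((F \<circ> real_of_ereal) \<longlongrightarrow> 0) (at_right 0)"
      unfolding zero_ereal_def ereal_tendsto_simps by simp
  next
    define M where "M = \<bar>\<rho>\<bar> + 1"
    have "(F \<longlongrightarrow> 0) at_top"
    proof (rule Lim_null_comparison)
      show "((\<lambda>t. (x + \<bar>\<rho>\<bar>) * exp (- x * t\<^sup>2 / 2 + M * t)) \<longlongrightarrow> 0) at_top"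
        using x by real_asymp
      show "eventually (\<lambda>t. norm (F t) \<le> (x + \<bar>\<rho>\<bar>) * exp (- x * t\<^sup>2 / 2 + M * t)) at_top"
        using eventually_ge_at_top[of 0]
      proof eventually_elim
        case (elim t)
        have "x * (t\<^sup>2 / 2) \<le> x * cosh t"
          using cosh_ge_quadratic[of t] x by (intro mult_left_mono) auto
        hence "- x * cosh t \<le> - x * t\<^sup>2 / 2" by simp
        hence 1: "exp (- x * cosh t) \<le> exp (- x * t\<^sup>2 / 2)" by simp
        have s: "\<bar>sinh t\<bar> \<le> exp t" using abs_sinh_le_exp_abs[of t] elim by simp
        have c: "\<bar>cosh (\<rho> * t)\<bar> \<le> exp (\<bar>\<rho>\<bar> * t)"
          using cosh_le_exp_abs[of "\<rho> * t"] elim by (simp add: abs_mult)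
        have "\<bar>x * sinh t * cosh (\<rho> * t)\<bar> \<le> x * exp t * exp (\<bar>\<rho>\<bar> * t)"
          unfolding abs_mult using s c x by (intro mult_mono) auto
        also have "\<dots> = x * exp (M * t)" by (simp add: M_def algebra_simps flip: exp_add)
        finally have 2: "\<bar>x * sinh t * cosh (\<rho> * t)\<bar> \<le> x * exp (M * t)" .
        have "\<bar>sinh (\<rho> * t)\<bar> \<le> exp (\<bar>\<rho>\<bar> * t)"
          using abs_sinh_le_exp_abs[of "\<rho> * t"] elim by (simp add: abs_mult)
        also have "\<dots> \<le> exp (M * t)" using elim by (simp add: M_def algebra_simps)
        finally have 3: "\<bar>\<rho> * sinh (\<rho> * t)\<bar> \<le> \<bar>\<rho>\<bar> * exp (M * t)"
          unfolding abs_mult by (intro mult_left_mono) auto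
        have "\<bar>x * sinh t * cosh (\<rho> * t) + \<rho> * sinh (\<rho> * t)\<bar> \<le> (x + \<bar>\<rho>\<bar>) * exp (M * t)"
          using 2 3 by (simp add: algebra_simps)
        hence "norm (F t) \<le> exp (- x * t\<^sup>2 / 2) * ((x + \<bar>\<rho>\<bar>) * exp (M * t))"
          unfolding F_def real_norm_def abs_mult using 1 by (intro mult_mono) auto
        thus ?case by (simp only: exp_add mult_ac)
      qed
    qed
    thus "((F \<circ> real_of_ereal) \<longlongrightarrow> 0) (at_left \<infinity>)"
      unfolding ereal_tendsto_simps .
  qed (use If in \<open>simp_all add: zero_ereal_def\<close>)
  hence "(LBINT t:{0<..}. f t) = 0"
    by (simp add: zero_ereal_def interval_integral_to_infinity_eq)
  moreover have "(LBINT t:{0<..}. f t) = x\<^sup>2 * (LBINT t:{0<..}. E 2 t) - x * (LBINT t:{0<..}. E 1 t)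
      - (x\<^sup>2 + \<rho>\<^sup>2) * (LBINT t:{0<..}. E 0 t)"
    unfolding f_def
    by (simp add: set_integral_diff set_integrable_mult_right I)
  ultimately show ?thesis unfolding bessel_moment_def E_def by simp
qed

lemma bessel_K_ode:
  obtains K' K'' where
    "\<And>x. x > 0 \<Longrightarrow> (bessel_K \<rho> has_real_derivative K' x) (at x)"
    "\<And>x. x > 0 \<Longrightarrow> (K' has_real_derivative K'' x) (at x)"
    "\<And>x. x > 0 \<Longrightarrow> x\<^sup>2 * K'' x + x * K' x - (x\<^sup>2 + \<rho>\<^sup>2) * bessel_K \<rho> x = 0"
proof (rule that)
  fix x :: real assume x: "x > 0"
  show "(bessel_K \<rho> has_real_derivative - bessel_moment \<rho> 1 x) (at x)"
    using DERIV_bessel_moment[OF x, of \<rho> 0] by (simp add: bessel_K_eq_moment)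
  show "((\<lambda>x. - bessel_moment \<rho> 1 x) has_real_derivative bessel_moment \<rho> 2 x) (at x)"
    using DERIV_minus[OF DERIV_bessel_moment[OF x, of \<rho> 1]] by (simp add: numeral_2_eq_2)
  show "x\<^sup>2 * bessel_moment \<rho> 2 x + x * - bessel_moment \<rho> 1 x - (x\<^sup>2 + \<rho>\<^sup>2) * bessel_K \<rho> x = 0"
    using bessel_moment_recurrence[OF x, of \<rho>] by (simp add: bessel_K_eq_moment)
qed

lemma bessel_K_asymp: "bessel_K \<rho> \<sim>[at_top] (\<lambda>x. sqrt (pi / (2 * x)) * exp (- x))"
proof -
  define G where "G x s = indicator {0<..} s *\<^sub>R
      (exp (- x * (cosh (s / sqrt x) - 1)) * cosh (\<rho> * s / sqrt x))" for x s :: real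
  have rescale: "bessel_K \<rho> x = exp (- x) / sqrt x * (LBINT s. G x s)" if "x > 0" for x
  proof -
    have "bessel_K \<rho> x = \<bar>1 / sqrt x\<bar> *\<^sub>R (LBINT s. indicator {0<..} (0 + 1 / sqrt x * s) *\<^sub>R
      (exp (- x * cosh (0 + 1 / sqrt x * s)) * cosh (\<rho> * (0 + 1 / sqrt x * s))))"
      unfolding bessel_K_def set_lebesgue_integral_def
      by (rule lborel_integral_real_affine) (use that in auto)
    also have "(\<lambda>s. indicator {0<..} (0 + 1 / sqrt x * s) *\<^sub>R
      (exp (- x * cosh (0 + 1 / sqrt x * s)) * cosh (\<rho> * (0 + 1 / sqrt x * s)))) = (\<lambda>s. exp (- x) * G x s)"
      using that by (auto simp: G_def indicator_def fun_eq_iff algebra_simps zero_less_divide_iff simp flip: exp_add)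
    finally show ?thesis using that by simp
  qed
  have "((\<lambda>x. LBINT s. G x s) \<longlongrightarrow> (LBINT s. indicator {0<..} s *\<^sub>R exp (- s\<^sup>2 / 2))) at_top"
  proof (rule integral_dominated_convergence_at_top)
    show "(\<lambda>s::real. indicator {0<..} s *\<^sub>R exp (- s\<^sup>2 / 2)) \<in> borel_measurable lborel"
      by measurable
    show "G x \<in> borel_measurable lborel" for x
    proof -
      have [measurable]: "(\<lambda>s. exp (- x * (cosh (s / sqrt x) - 1)) * cosh (\<rho> * s / sqrt x)) \<in> borel_measurable borel"
        by (cases "x = 0") (auto intro!: borel_measurable_continuous_onI continuous_intros)
      show ?thesis unfolding G_def by measurable
    qed
    show "integrable lborel (\<lambda>s. exp (- 1 * s\<^sup>2 / 2 + \<bar>\<rho>\<bar> * s))"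
      by (rule integrable_gaussian_exp) simp
    show "AE s in lborel. ((\<lambda>x. G x s) \<longlongrightarrow> indicator {0<..} s *\<^sub>R exp (- s\<^sup>2 / 2)) at_top"
    proof (rule AE_I2)
      fix s :: real
      have 1: "((\<lambda>x. x * (cosh (s / sqrt x) - 1)) \<longlongrightarrow> s\<^sup>2 / 2) at_top" if "s > 0"
        using that unfolding cosh_def by (simp, real_asymp simp: power2_eq_square field_simps)
      have "((\<lambda>x. \<rho> * s / sqrt x) \<longlongrightarrow> 0) at_top" by real_asymp
      hence 2: "((\<lambda>x. cosh (\<rho> * s / sqrt x)) \<longlongrightarrow> cosh 0) at_top"
        by (intro tendsto_intros)
      have "((\<lambda>x. exp (- (x * (cosh (s / sqrt x) - 1))) * cosh (\<rho> * s / sqrt x))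
          \<longlongrightarrow> exp (- (s\<^sup>2 / 2)) * cosh 0) at_top" if "s > 0"
        by (intro tendsto_mult tendsto_exp tendsto_minus 1 2 that)
      thus "((\<lambda>x. G x s) \<longlongrightarrow> indicator {0<..} s *\<^sub>R exp (- s\<^sup>2 / 2)) at_top"
        by (cases "s > 0") (auto simp: G_def)
    qed
    show "eventually (\<lambda>x. AE s in lborel. norm (G x s) \<le> exp (- 1 * s\<^sup>2 / 2 + \<bar>\<rho>\<bar> * s)) at_top"
      using eventually_ge_at_top[of 1]
    proof eventually_elim
      case (elim x)
      have "norm (G x s) \<le> exp (- 1 * s\<^sup>2 / 2 + \<bar>\<rho>\<bar> * s)" if s: "s > 0" for s
      proof -
        have "x * ((s / sqrt x)\<^sup>2 / 2) \<le> x * (cosh (s / sqrt x) - 1)"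
          using cosh_ge_quadratic[of "s / sqrt x"] elim by (intro mult_left_mono) auto
        hence 1: "- x * (cosh (s / sqrt x) - 1) \<le> - 1 * s\<^sup>2 / 2"
          using elim by (simp add: power_divide)
        have "\<bar>\<rho> * s / sqrt x\<bar> \<le> \<bar>\<rho>\<bar> * s"
          using elim s mult_left_mono[of 1 "sqrt x" "\<bar>\<rho>\<bar> * s"]
          by (simp add: abs_mult divide_le_eq del: mult_le_cancel_left1)
        hence "cosh (\<rho> * s / sqrt x) \<le> exp (\<bar>\<rho>\<bar> * s)"
          using cosh_le_exp_abs[of "\<rho> * s / sqrt x"] by (meson exp_le_cancel_iff order_trans)
        with 1 have "exp (- x * (cosh (s / sqrt x) - 1)) * cosh (\<rho> * s / sqrt x)
            \<le> exp (- 1 * s\<^sup>2 / 2) * exp (\<bar>\<rho>\<bar> * s)"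
          by (intro mult_mono) auto
        hence "exp (- x * (cosh (s / sqrt x) - 1)) * cosh (\<rho> * s / sqrt x)
            \<le> exp (- 1 * s\<^sup>2 / 2 + \<bar>\<rho>\<bar> * s)"
          by (simp only: exp_add)
        thus ?thesis using s by (simp add: G_def)
      qed
      moreover have "norm (G x s) \<le> exp (- 1 * s\<^sup>2 / 2 + \<bar>\<rho>\<bar> * s)" if "\<not> s > 0" for s
        using that by (simp add: G_def)
      ultimately show ?case by blast
    qed
  qed
  also have "(LBINT s. indicator {0<..} s *\<^sub>R exp (- s\<^sup>2 / 2)) = sqrt (pi / 2)"
  proof -
    have "(LBINT s. indicator {0<..} s *\<^sub>R exp (- s\<^sup>2 / 2)) =
       \<bar>sqrt 2\<bar> *\<^sub>R (LBINT s. indicator {0<..} (0 + sqrt 2 * s) *\<^sub>R exp (- (0 + sqrt 2 * s)\<^sup>2 / 2))"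
      by (rule lborel_integral_real_affine) simp
    also have "(\<lambda>s. indicator {0<..} (0 + sqrt 2 * s) *\<^sub>R exp (- (0 + sqrt 2 * s)\<^sup>2 / 2))
       = (\<lambda>s. indicator {0<..} s *\<^sub>R exp (- s\<^sup>2))"
      by (auto simp: fun_eq_iff indicator_def power_mult_distrib zero_less_mult_iff)
    also have "(LBINT s. indicator {0<..} s *\<^sub>R exp (- s\<^sup>2)) = (LBINT s. indicator {0..} s *\<^sub>R exp (- s\<^sup>2 :: real))"
      by (rule integral_cong_AE) (use AE_lborel_singleton[of "0::real"] in \<open>auto simp: indicator_def elim!: eventually_mono\<close>)
    also have "\<dots> = sqrt pi / 2"
      using gaussian_moment_0 by (rule has_bochner_integral_integral_eq)
    also have "\<bar>sqrt 2\<bar> *\<^sub>R (sqrt pi / 2) = sqrt (pi / 2)"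
      by (simp add: real_sqrt_divide real_div_sqrt field_simps)
    finally show ?thesis .
  qed
  finally have lim: "((\<lambda>x. LBINT s. G x s) \<longlongrightarrow> sqrt (pi / 2)) at_top" .
  have "((\<lambda>x. (LBINT s. G x s) / sqrt (pi / 2)) \<longlongrightarrow> sqrt (pi / 2) / sqrt (pi / 2)) at_top"
    by (intro tendsto_intros lim) auto
  hence "((\<lambda>x. (LBINT s. G x s) / sqrt (pi / 2)) \<longlongrightarrow> 1) at_top" by simp
  moreover have "eventually (\<lambda>x. (LBINT s. G x s) / sqrt (pi / 2)
      = bessel_K \<rho> x / (sqrt (pi / (2 * x)) * exp (- x))) at_top"
    using eventually_gt_at_top[of 0]
    by eventually_elim (simp add: rescale real_sqrt_divide real_sqrt_mult field_simps)
  ultimately have "((\<lambda>x. bessel_K \<rho> x / (sqrt (pi / (2 * x)) * exp (- x))) \<longlongrightarrow> 1) at_top"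
    by (rule Lim_transform_eventually)
  thus ?thesis by (rule asymp_equivI')
qed

end

theory Submission
  imports Defs
begin

text \<open>
  With \<open>G x = \<integral>\<^sub>x\<^sup>\<infinity> a(y) y\<^bsup>-\<nu>-1\<^esup> f(y) dy\<close> the equation reads
  \<open>x f'' = - (x\<^bsup>\<nu>+2\<^esup> G)'\<close>, so \<open>x f' - f + x\<^bsup>\<nu>+2\<^esup> G\<close> is constant, and the conditions at
  infinity force the constant to be zero. Eliminating \<open>G\<close> with the equation leaves the
  local equation \<open>x\<^sup>2 f'' = (\<nu> + 2) (x f' - f) + A x\<^bsup>\<gamma>+2\<^esup> f\<close>. The Wronskian of two of its
  solutions is a multiple of \<open>x\<^bsup>\<nu>+2\<^esup>\<close>; for stationary solutions it vanishes at infinity, hence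
  identically, so that any stationary solution is a multiple of a positive one. The substitution
  \<open>f(x) = x\<^bsup>(\<nu>+3)/2\<^esup> K(\<beta> x\<^bsup>(\<gamma>+2)/2\<^esup>)\<close> turns the local equation into the modified Bessel
  equation. Integrability at the origin and at infinity follows from
  \<open>exp (- u) \<le> p\<^bsup>p\<^esup> u\<^bsup>-p\<^esup>\<close>, applied under the integral defining the Bessel function.
\<close>

section \<open>Integrals over half-lines\<close>

text \<open>For a nonnegative integrand, finite limits of an antiderivative at both ends already
  give integrability, so existence and value of an integral come from the same
  antiderivative.\<close>

lemma FTC_greaterThan_nonneg:
  fixes F f :: "real \<Rightarrow> real"
  assumes "\<And>x. a < x \<Longrightarrow> (F has_real_derivative f x) (at x)"
    and "\<And>x. a < x \<Longrightarrow> isCont f x"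
    and "\<And>x. a < x \<Longrightarrow> 0 \<le> f x"
    and "(F \<longlongrightarrow> l) (at_right a)" and "(F \<longlongrightarrow> m) at_top"
  shows "set_integrable lborel {a<..} f" and "(LBINT x:{a<..}. f x) = m - l"
proof -
  have *: "set_integrable lborel (einterval (ereal a) \<infinity>) f" "(LBINT x=ereal a..\<infinity>. f x) = m - l"
    by (rule interval_integral_FTC_nonneg[of "ereal a" \<infinity> F f l m];
        use assms in \<open>auto simp: ereal_tendsto_simps\<close>)+
  show "set_integrable lborel {a<..} f" using *(1) by simp
  show "(LBINT x:{a<..}. f x) = m - l"
    using *(2) by (simp add: interval_integral_to_infinity_eq)
qed

lemma set_borel_measurable_continuous_greaterThan:
  fixes h :: "real \<Rightarrow> real"
  assumes "continuous_on {a<..} h"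
  shows "set_borel_measurable lborel {a<..} h"
  unfolding set_borel_measurable_def
  using borel_measurable_continuous_on_indicator[OF _ assms] by simp

text \<open>The dominating function has the antiderivative \<open>- 1 / (\<epsilon> * (1 + x powr \<epsilon>))\<close>.\<close>

lemma set_integrable_powr_bounds:
  fixes h :: "real \<Rightarrow> real"
  assumes "\<epsilon> > 0" and cont: "continuous_on {0<..} h"
    and h1: "\<And>x. x > 0 \<Longrightarrow> \<bar>h x\<bar> \<le> C * x powr (\<epsilon> - 1)"
    and h2: "\<And>x. x > 0 \<Longrightarrow> \<bar>h x\<bar> \<le> D * x powr (- \<epsilon> - 1)"
  shows "set_integrable lborel {0<..} h"
proof (rule set_integrable_bound)
  \<comment> \<open>Of order \<open>x powr (\<epsilon> - 1)\<close> at the origin and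
    \<open>x powr (- \<epsilon> - 1)\<close> at infinity, so that \<open>w\<close> follows the
    sharper of the two power bounds at each end.\<close>
  define w where "w x = x powr (\<epsilon> - 1) / (1 + x powr \<epsilon>)\<^sup>2" for x :: real
  have pos: "1 + x powr \<epsilon> > 0" for x :: real by (simp add: add_pos_nonneg)
  have "set_integrable lborel {0<..} w"
  proof (rule FTC_greaterThan_nonneg)
    fix x :: real assume x: "0 < x"
    show "((\<lambda>x. - 1 / (\<epsilon> * (1 + x powr \<epsilon>))) has_real_derivative w x) (at x)"
    proof (rule DERIV_cong)
      show "((\<lambda>x. - 1 / (\<epsilon> * (1 + x powr \<epsilon>))) has_real_derivative
          \<epsilon> * (\<epsilon> * x powr (\<epsilon> - 1)) / (\<epsilon> * (1 + x powr \<epsilon>))\<^sup>2) (at x)"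
        using x pos[of x] assms(1) by (auto intro!: derivative_eq_intros simp: power2_eq_square)
      show "\<epsilon> * (\<epsilon> * x powr (\<epsilon> - 1)) / (\<epsilon> * (1 + x powr \<epsilon>))\<^sup>2 = w x"
        unfolding w_def using assms(1) pos[of x] by (simp add: power2_eq_square)
    qed
    show "isCont w x" unfolding w_def using x pos[of x]
      by (intro continuous_intros) auto
    show "0 \<le> w x" by (simp add: w_def)
  next
    show "((\<lambda>x. - 1 / (\<epsilon> * (1 + x powr \<epsilon>))) \<longlongrightarrow> - 1 / (\<epsilon> * (1 + 0))) (at_right 0)"
    proof (intro tendsto_intros)
      show "((\<lambda>x. x powr \<epsilon>) \<longlongrightarrow> 0) (at_right 0)" using assms(1) by real_asymp
    qed (use assms in auto)
    show "((\<lambda>x. - 1 / (\<epsilon> * (1 + x powr \<epsilon>))) \<longlongrightarrow> 0) at_top" using assms(1) by real_asymp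
  qed
  thus "set_integrable lborel {0<..} (\<lambda>x. 4 * max C D * w x)" by (rule set_integrable_mult_right)
  show "set_borel_measurable lborel {0<..} h"
    by (rule set_borel_measurable_continuous_greaterThan[OF cont])
  have "\<bar>h x\<bar> \<le> 4 * max C D * w x" if x: "x > 0" for x
  proof -
    have nn: "max C D \<ge> 0"
      using h1[of 1] h2[of 1] by auto
    \<comment> \<open>The factor 4 is the square of 2: \<open>1 + x powr \<epsilon>\<close> is at
      most 2 for \<open>x \<le> 1\<close> and at most \<open>2 * x powr \<epsilon>\<close>
      otherwise.\<close>
    have "x powr (\<epsilon> - 1) \<le> 4 * w x \<or> x powr (- \<epsilon> - 1) \<le> 4 * w x"
    proof (cases "x \<le> 1")
      case True
      have "x powr \<epsilon> \<le> 1" using True x assms(1) powr_mono2[of \<epsilon> x 1] by simp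
      hence "(1 + x powr \<epsilon>)\<^sup>2 \<le> 2\<^sup>2" by (intro power_mono) auto
      hence "x powr (\<epsilon> - 1) * (1 + x powr \<epsilon>)\<^sup>2 \<le> x powr (\<epsilon> - 1) * 4"
        by (intro mult_left_mono) auto
      thus ?thesis using pos[of x] by (simp add: w_def field_simps)
    next
      case False
      have "1 \<le> x powr \<epsilon>" using False assms(1) ge_one_powr_ge_zero[of x \<epsilon>] by simp
      hence "(1 + x powr \<epsilon>)\<^sup>2 \<le> (2 * x powr \<epsilon>)\<^sup>2" by (intro power_mono) auto
      hence "x powr (- \<epsilon> - 1) * (1 + x powr \<epsilon>)\<^sup>2 \<le> x powr (- \<epsilon> - 1) * (4 * (x powr \<epsilon> * x powr \<epsilon>))"
        by (intro mult_left_mono) (auto simp: power2_eq_square)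
      also have "\<dots> = 4 * x powr (\<epsilon> - 1)"
        by (simp add: algebra_simps flip: powr_add)
      finally show ?thesis using pos[of x] by (simp add: w_def field_simps)
    qed
    thus ?thesis
    proof
      assume *: "x powr (\<epsilon> - 1) \<le> 4 * w x"
      have "\<bar>h x\<bar> \<le> max C D * x powr (\<epsilon> - 1)"
        using h1[OF x] by (rule order_trans) (intro mult_right_mono, auto)
      also have "\<dots> \<le> max C D * (4 * w x)" by (intro mult_left_mono * nn)
      finally show ?thesis by simp
    next
      assume *: "x powr (- \<epsilon> - 1) \<le> 4 * w x"
      have "\<bar>h x\<bar> \<le> max C D * x powr (- \<epsilon> - 1)"
        using h2[OF x] by (rule order_trans) (intro mult_right_mono, auto)
      also have "\<dots> \<le> max C D * (4 * w x)" by (intro mult_left_mono * nn)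
      finally show ?thesis by simp
    qed
  qed
  thus "AE x in lborel. x \<in> {0<..} \<longrightarrow> norm (h x) \<le> norm (4 * max C D * w x)"
    by (intro AE_I2) (smt (verit) greaterThan_iff real_norm_def)
qed

text \<open>A vanishing integral would force the nonnegative integrand to be zero almost everywhere,
  and the half-line would be a null set although it contains an interval of length 1.\<close>

lemma set_integral_greaterThan_pos:
  fixes h :: "real \<Rightarrow> real"
  assumes int: "set_integrable lborel {a<..} h" and pos: "\<And>x. x > a \<Longrightarrow> h x > 0"
  shows "(LBINT x:{a<..}. h x) > 0"
proof -
  let ?h = "\<lambda>x. indicator {a<..} x *\<^sub>R h x"
  have nn: "AE x in lborel. 0 \<le> ?h x"
    using pos by (intro AE_I2) (auto simp: indicator_def intro: less_imp_le)
  have "(LBINT x. ?h x) \<noteq> 0"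
  proof
    assume "(LBINT x. ?h x) = 0"
    hence "AE x in lborel. ?h x = 0"
      using integral_nonneg_eq_0_iff_AE[OF int[unfolded set_integrable_def] nn] by simp
    hence "AE x in lborel. x \<notin> {a<..}"
      by eventually_elim (use pos in \<open>force simp: indicator_def\<close>)
    hence "{a<..} \<in> null_sets lborel"
      by (subst (asm) AE_iff_null_sets[symmetric]) auto
    hence "emeasure lborel {a<..} = 0" by auto
    moreover have "emeasure lborel {a<..<a+1} \<le> emeasure lborel {a<..}"
      by (intro emeasure_mono) auto
    ultimately show False by simp
  qed
  moreover have "(LBINT x. ?h x) \<ge> 0" by (rule integral_nonneg_AE[OF nn])
  ultimately show ?thesis by (simp add: set_lebesgue_integral_def)
qed

section \<open>Power bounds for the Bessel moments\<close>

text \<open>This is \<open>ln s \<le> s - 1\<close> at \<open>s = u / p\<close>, multiplied by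
  \<open>p\<close> and exponentiated, with the factor \<open>exp (- p)\<close> bounded by 1.\<close>

lemma exp_minus_le_powr:
  assumes "p > 0" "u > (0::real)"
  shows "exp (- u) \<le> p powr p * u powr (- p)"
proof -
  have "ln (u / p) \<le> u / p - 1" by (rule ln_le_minus_one) (use assms in simp)
  hence "p * (ln u - ln p) \<le> p * (u / p - 1)"
    using assms by (intro mult_left_mono) (auto simp: ln_div)
  hence "- u \<le> p * ln p - p * ln u" using assms by (simp add: algebra_simps)
  hence "exp (- u) \<le> exp (p * ln p + - p * ln u)" by simp
  also have "\<dots> = p powr p * u powr (- p)"
    using assms by (simp only: exp_add powr_def) auto
  finally show ?thesis .
qed

lemma bessel_moment_pos:
  assumes "x > 0"
  shows "bessel_moment \<rho> k x > 0"
  unfolding bessel_moment_def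
  by (rule set_integral_greaterThan_pos[OF bessel_integrand_integrable[OF assms]]) simp

text \<open>Under the integral, \<open>exp (- u)\<close> is bounded at
  \<open>u = x * cosh t\<close>. The power of \<open>x\<close> comes out, and the remaining
  integrand in \<open>t\<close> decays exponentially because \<open>p\<close> exceeds
  \<open>\<bar>\<rho>\<bar> + real k\<close>. Small \<open>p\<close> controls the origin, large
  \<open>p\<close> gives decay at infinity.\<close>

lemma bessel_moment_le_powr:
  assumes p: "p > \<bar>\<rho>\<bar> + real k"
  shows "\<exists>C. \<forall>x>0. bessel_moment \<rho> k x \<le> C * x powr (- p)"
proof -
  define c where "c = p - real k - \<bar>\<rho>\<bar>"
  have c: "c > 0" and p0: "p > 0" and pk: "p > real k" using p by (auto simp: c_def)
  have int: "set_integrable lborel {0<..} (\<lambda>t. exp (- c * t))"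
  proof (rule FTC_greaterThan_nonneg)
    show "((\<lambda>t. - exp (- c * t) / c) \<longlongrightarrow> 0) at_top" using c by real_asymp
    show "((\<lambda>t. - exp (- c * t) / c) \<longlongrightarrow> - exp (- c * 0) / c) (at_right 0)"
      by (intro tendsto_intros) (use c in auto)
  qed (use c in \<open>auto intro!: derivative_eq_intros tendsto_intros continuous_intros\<close>)
  have bound: "exp (- x * cosh t) * cosh (\<rho> * t) * cosh t ^ k
      \<le> p powr p * 2 powr (p - k) * x powr (- p) * exp (- c * t)" if x: "x > 0" and t: "t > 0" for x t
  proof -
    have "exp (- x * cosh t) \<le> p powr p * (x * cosh t) powr (- p)"
      using exp_minus_le_powr[OF p0, of "x * cosh t"] x by simp
    moreover have "cosh (\<rho> * t) \<le> exp (\<bar>\<rho>\<bar> * t)"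
      using cosh_le_exp_abs[of "\<rho> * t"] t by (simp add: abs_mult)
    ultimately have "exp (- x * cosh t) * cosh (\<rho> * t) * cosh t ^ k
        \<le> p powr p * (x * cosh t) powr (- p) * exp (\<bar>\<rho>\<bar> * t) * cosh t ^ k"
      by (intro mult_mono mult_right_mono) auto
    also have "\<dots> = p powr p * x powr (- p) * exp (\<bar>\<rho>\<bar> * t) * cosh t powr (- (p - k))"
      using x by (simp add: powr_mult powr_diff powr_realpow powr_minus field_simps)
    \<comment> \<open>The exponent \<open>- (p - k)\<close> is negative, so a lower bound for
      \<open>cosh t\<close> is what is needed.\<close>
    also have "\<dots> \<le> p powr p * x powr (- p) * exp (\<bar>\<rho>\<bar> * t) * (exp t / 2) powr (- (p - k))"
    proof (intro mult_left_mono powr_mono2')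
      show "exp t / 2 \<le> cosh t" by (simp add: cosh_field_def)
    qed (use pk in auto)
    also have "(exp t / 2) powr (- (p - k)) = 2 powr (p - k) * exp (- (p - k) * t)"
      by (simp add: powr_divide powr_minus exp_powr_real field_simps exp_minus, simp flip: powr_add)
    also have "p powr p * x powr (- p) * exp (\<bar>\<rho>\<bar> * t) * (2 powr (p - k) * exp (- (p - k) * t))
       = p powr p * 2 powr (p - k) * x powr (- p) * (exp (\<bar>\<rho>\<bar> * t) * exp (- (p - k) * t))" by simp
    also have "exp (\<bar>\<rho>\<bar> * t) * exp (- (p - k) * t) = exp (- c * t)"
      by (simp add: c_def algebra_simps flip: exp_add)
    finally show ?thesis .
  qed
  show ?thesis
  proof (intro exI allI impI)
    fix x :: real assume x: "x > 0"
    have "bessel_moment \<rho> k x \<le> (LBINT t:{0<..}. p powr p * 2 powr (p - k) * x powr (- p) * exp (- c * t))"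
      unfolding bessel_moment_def
      by (rule set_integral_mono[OF bessel_integrand_integrable[OF x] set_integrable_mult_right[OF int]])
         (use bound x in auto)
    also have "\<dots> = p powr p * 2 powr (p - k) * (LBINT t:{0<..}. exp (- c * t)) * x powr (- p)"
      by simp
    finally show "bessel_moment \<rho> k x \<le> \<dots>" .
  qed
qed

section \<open>Tail integrals\<close>

text \<open>Dominated convergence: every point eventually leaves \<open>{x<..}\<close>. The second
  indicator, which changes nothing once \<open>x \<ge> a\<close>, confines the integrand to the set
  on which integrability is known.\<close>

lemma tendsto_set_integral_greaterThan:
  fixes h :: "real \<Rightarrow> real"
  assumes int: "set_integrable lborel {a<..} h"
  shows "((\<lambda>x. LBINT y:{x<..}. h y) \<longlongrightarrow> 0) at_top"
proof -
  have "((\<lambda>x. LBINT y. indicator {x<..} y *\<^sub>R (indicator {a<..} y *\<^sub>R h y)) \<longlongrightarrow> (\<integral>y. 0 \<partial>(lborel :: real measure))) at_top"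
  proof (rule integral_dominated_convergence_at_top)
    let ?w = "\<lambda>y. indicator {a<..} y *\<^sub>R h y"
    have [measurable]: "?w \<in> borel_measurable lborel"
      using int unfolding set_integrable_def by (rule borel_measurable_integrable)
    show "(\<lambda>y. indicator {x<..} y *\<^sub>R ?w y) \<in> borel_measurable lborel" for x by measurable
    show "integrable lborel (\<lambda>y. norm (?w y))"
      using int unfolding set_integrable_def by (rule integrable_norm)
    show "AE y in lborel. ((\<lambda>x. indicator {x<..} y *\<^sub>R ?w y) \<longlongrightarrow> 0) at_top"
    proof (rule AE_I2)
      fix y :: real
      have "eventually (\<lambda>x. indicator {x<..} y *\<^sub>R ?w y = 0) at_top"
        using eventually_ge_at_top[of y] by eventually_elim simp
      thus "((\<lambda>x. indicator {x<..} y *\<^sub>R ?w y) \<longlongrightarrow> 0) at_top" by (rule tendsto_eventually)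
    qed
    show "\<forall>\<^sub>F x in at_top. AE y in lborel. norm (indicator {x<..} y *\<^sub>R ?w y) \<le> norm (?w y)"
      by (intro always_eventually allI AE_I2) (auto simp: indicator_def)
  qed simp
  hence "((\<lambda>x. LBINT y. indicator {x<..} y *\<^sub>R (indicator {a<..} y *\<^sub>R h y)) \<longlongrightarrow> 0) at_top" by simp
  moreover have "eventually (\<lambda>x. (LBINT y. indicator {x<..} y *\<^sub>R (indicator {a<..} y *\<^sub>R h y))
      = (LBINT y:{x<..}. h y)) at_top"
    using eventually_ge_at_top[of a]
    by eventually_elim
       (auto simp: set_lebesgue_integral_def indicator_def intro!: Bochner_Integration.integral_cong)
  ultimately show ?thesis by (rule Lim_transform_eventually)
qed

text \<open>Near \<open>x\<close> the tail beyond \<open>2 * x\<close> is a constant, so only an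
  integral over a compact interval varies, and the fundamental theorem of calculus applies to
  it.\<close>

lemma has_real_derivative_set_integral_greaterThan:
  fixes h :: "real \<Rightarrow> real"
  assumes int: "\<And>x. x > 0 \<Longrightarrow> set_integrable lborel {x<..} h"
    and cont: "continuous_on {0<..} h" and x: "x > 0"
  shows "((\<lambda>x. LBINT y:{x<..}. h y) has_real_derivative - h x) (at x)"
proof -
  have split: "(LBINT z:{y<..}. h z) = integral {y..2*x} h + (LBINT z:{2*x<..}. h z)"
    if y: "y \<in> {x/2<..<2*x}" for y
  proof -
    have y0: "y > 0" using y x by auto
    have sub: "set_integrable lborel {y<..2*x} h" "set_integrable lborel {2*x<..} h"
      by (rule set_integrable_subset[OF int[OF y0]]; use y in auto)+
    have *: "{y<..} = {y<..2*x} \<union> {2*x<..}" using y by auto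
    have "(LBINT z:{y<..}. h z) = (LBINT z:{y<..2*x}. h z) + (LBINT z:{2*x<..}. h z)"
      by (subst *) (rule set_integral_Un[OF _ sub], auto)
    also have "(LBINT z:{y<..2*x}. h z) = integral {y<..2*x} h"
      by (rule set_borel_integral_eq_integral(2)[OF sub(1)])
    also have "\<dots> = integral {y..2*x} h"
      by (rule integral_subset_negligible) (auto intro: negligible_subset[of "{y}"])
    finally show ?thesis .
  qed
  have "((\<lambda>y. integral {y..2*x} h) has_real_derivative - h x) (at x within {x/2..2*x})"
    by (rule integral_has_real_derivative')
       (use x in \<open>auto intro: continuous_on_subset[OF cont]\<close>)
  hence "((\<lambda>y. integral {y..2*x} h) has_real_derivative - h x) (at x)"
    using at_within_Icc_at[of "x/2" x "2*x"] x by simp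
  hence "((\<lambda>y. integral {y..2*x} h + (LBINT z:{2*x<..}. h z)) has_real_derivative - h x) (at x)"
    by (auto intro!: derivative_eq_intros)
  thus ?thesis
    by (rule has_field_derivative_transform_within_open[where S = "{x/2<..<2*x}"])
       (use x split in auto)
qed

section \<open>The local equation and uniqueness up to a factor\<close>

lemma stationary_solution_ode:
  fixes A \<gamma> \<nu> :: real
  assumes \<nu>: "-2 < \<nu>"
    and sol: "stationary_solution (frag_rate A \<gamma>) (frag_kernel \<nu>) g"
    and x: "x > 0"
  shows "x\<^sup>2 * deriv (deriv g) x = (\<nu> + 2) * (x * deriv g x - g x) + x\<^sup>2 * frag_rate A \<gamma> x * g x"
proof -
  define a where "a = frag_rate A \<gamma>"
  define h where "h y = y powr (- \<nu> - 1) * (a y * g y)" for y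
  define G where "G x = (LBINT y:{x<..}. h y)" for x
  define \<Phi> where "\<Phi> x = x * deriv g x - g x + x powr (\<nu> + 2) * G x" for x
  have g0: "g y \<ge> 0" if "y > 0" for y
    using sol that by (auto simp: stationary_solution_def)
  have cont: "continuous_on {0<..} g"
    using sol by (auto simp: stationary_solution_def intro: continuous_on_subset)
  have lim0: "(g \<longlongrightarrow> 0) at_top" and lim1: "((\<lambda>z. z * deriv g z) \<longlongrightarrow> 0) at_top"
    using sol by (auto simp: stationary_solution_def)
  have "(deriv ^^ 0) g field_differentiable at y" "(deriv ^^ 1) g field_differentiable at y" if "y > 0" for y
    using sol that unfolding stationary_solution_def by blast+
  hence D1: "(g has_real_derivative deriv g y) (at y)"
    and D2: "(deriv g has_real_derivative deriv (deriv g) y) (at y)" if "y > 0" for y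
    using that by (auto simp: field_differentiable_derivI)
  have hcont: "continuous_on {0<..} h"
    unfolding h_def a_def frag_rate_def by (intro continuous_intros cont) auto
  have "in_X 1 (\<lambda>y. a y * g y)"
    using sol by (simp add: stationary_solution_def a_def)
  hence "set_integrable lborel {0<..} (\<lambda>y. y powr 1 * (a y * g y))" by (simp add: in_X_def)
  hence I1: "set_integrable lborel {y<..} (\<lambda>y. y powr 1 * (a y * g y))" if "y \<ge> 0" for y
    by (rule set_integrable_subset) (use that in auto)
  \<comment> \<open>Since \<open>y < z\<close> and \<open>\<nu> + 2 > 0\<close>, the prefactor
    raises the power of \<open>z\<close> to at most 1. This first-moment bound yields both the
    integrability of \<open>h\<close> on tails and the decay of
    \<open>y powr (\<nu> + 2) * G y\<close>.\<close>
  have bound: "\<bar>y powr (\<nu> + 2) * h z\<bar> \<le> \<bar>z powr 1 * (a z * g z)\<bar>" if "0 < y" "y < z" for y z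
  proof -
    have "y powr (\<nu> + 2) \<le> z powr (\<nu> + 2)" using that \<nu> by (intro powr_mono2) auto
    hence "y powr (\<nu> + 2) * \<bar>h z\<bar> \<le> z powr (\<nu> + 2) * \<bar>h z\<bar>" by (intro mult_right_mono) auto
    also have "\<dots> = z powr (\<nu> + 2) * z powr (- \<nu> - 1) * \<bar>a z * g z\<bar>"
      by (simp add: h_def abs_mult)
    also have "z powr (\<nu> + 2) * z powr (- \<nu> - 1) = z powr 1" by (simp flip: powr_add)
    finally show ?thesis by (simp add: abs_mult)
  qed
  have int': "set_integrable lborel {y<..} (\<lambda>z. y powr (\<nu> + 2) * h z)" if "y > 0" for y
  proof (rule set_integrable_bound[OF I1])
    show "set_borel_measurable lborel {y<..} (\<lambda>z. y powr (\<nu> + 2) * h z)"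
      by (intro set_borel_measurable_continuous_greaterThan continuous_intros
            continuous_on_subset[OF hcont]) (use that in auto)
  qed (use that bound in auto)
  have int: "set_integrable lborel {y<..} h" if "y > 0" for y
    using set_integrable_mult_right[where a = "y powr - (\<nu> + 2)", OF int'[OF that]] that
    by (simp add: powr_minus field_simps)
  \<comment> \<open>The kernel separates its variables, so the integral term is a power of
    \<open>y\<close> times the tail integral \<open>G\<close>.\<close>
  have eq: "(\<nu> + 2) * y powr \<nu> * G y = - deriv (deriv g) y + a y * g y" if "y > 0" for y
  proof -
    have "- deriv (deriv g) y + a y * g y = (LBINT z:{y<..}. a z * frag_kernel \<nu> y z * g z)"
      using sol that by (simp add: stationary_solution_def a_def numeral_2_eq_2)
    also have "\<dots> = (LBINT z:{y<..}. (\<nu> + 2) * y powr \<nu> * h z)"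
      using that by (intro set_lebesgue_integral_cong)
        (auto simp: frag_kernel_def h_def powr_diff powr_minus powr_add field_simps)
    finally show ?thesis by (simp add: G_def)
  qed
  have DG: "(G has_real_derivative - h y) (at y)" if "y > 0" for y
    unfolding G_def by (rule has_real_derivative_set_integral_greaterThan[OF int hcont that])
  \<comment> \<open>By the equation, differentiating the power in front of \<open>G\<close> produces
    \<open>y\<close> times the local side of the equation. This cancels the second derivative of
    \<open>g\<close> together with the contribution of \<open>h\<close>.\<close>
  have "(\<Phi> has_real_derivative 0) (at y)" if y: "y > 0" for y
  proof -
    have "(\<Phi> has_real_derivative deriv g y + y * deriv (deriv g) y - deriv g y
        + ((\<nu> + 2) * y powr (\<nu> + 2 - 1) * G y - y powr (\<nu> + 2) * h y)) (at y)"
      unfolding \<Phi>_def using y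
      by (auto intro!: derivative_eq_intros D1 D2 DG)
    moreover have "y powr (\<nu> + 2 - 1) = y powr (\<nu> + 1)"
      by (rule arg_cong[where f = "\<lambda>t. y powr t"]) simp
    then have e: "y powr (\<nu> + 2 - 1) = y powr \<nu> * y"
      using y by (simp only: powr_add powr_one)
    have "(\<nu> + 2) * y powr (\<nu> + 2 - 1) * G y = y * (- deriv (deriv g) y + a y * g y)"
      unfolding e eq[OF y, symmetric] by (simp only: mult_ac)
    moreover have "y powr (\<nu> + 2) * h y = y * (a y * g y)"
      using y by (simp add: h_def flip: powr_add mult.assoc)
    ultimately show ?thesis by (simp add: algebra_simps)
  qed
  hence "\<exists>c. \<forall>y\<in>{0<..}. \<Phi> y = c"
    by (intro has_field_derivative_zero_constant) (auto intro: has_field_derivative_at_within)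
  then obtain c where c: "\<And>y. y > 0 \<Longrightarrow> \<Phi> y = c" by auto
  have "((\<lambda>y. y powr (\<nu> + 2) * G y) \<longlongrightarrow> 0) at_top"
  proof (rule Lim_null_comparison)
    show "((\<lambda>y. LBINT z:{y<..}. \<bar>z powr 1 * (a z * g z)\<bar>) \<longlongrightarrow> 0) at_top"
      by (rule tendsto_set_integral_greaterThan[OF set_integrable_abs[OF I1[of 0]]]) simp
    show "\<forall>\<^sub>F y in at_top. norm (y powr (\<nu> + 2) * G y) \<le> (LBINT z:{y<..}. \<bar>z powr 1 * (a z * g z)\<bar>)"
      using eventually_gt_at_top[of 0]
    proof eventually_elim
      case (elim y)
      have "norm (y powr (\<nu> + 2) * G y) = norm (LBINT z:{y<..}. y powr (\<nu> + 2) * h z)"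
        by (simp add: G_def)
      also have "\<dots> \<le> (LBINT z:{y<..}. norm (y powr (\<nu> + 2) * h z))"
        by (rule set_integral_norm_bound[OF int'[OF elim]])
      also have "\<dots> \<le> (LBINT z:{y<..}. \<bar>z powr 1 * (a z * g z)\<bar>)"
        unfolding real_norm_def
        by (intro set_integral_mono set_integrable_abs int' I1) (use elim bound in auto)
      finally show ?case .
    qed
  qed
  hence "(\<Phi> \<longlongrightarrow> 0 - 0 + 0) at_top"
    unfolding \<Phi>_def by (intro tendsto_intros lim0 lim1)
  moreover have "(\<Phi> \<longlongrightarrow> c) at_top"
    by (rule tendsto_eventually) (use c in \<open>auto intro: eventually_mono[OF eventually_gt_at_top[of 0]]\<close>)
  ultimately have "c = 0" using tendsto_unique[of at_top \<Phi> c 0] by simp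
  \<comment> \<open>With the constant equal to zero, the nonlocal quantity \<open>G\<close> is
    expressed by \<open>g\<close> and its derivative at the same point.\<close>
  hence "x powr (\<nu> + 2) * G x = g x - x * deriv g x" using c[OF x] by (simp add: \<Phi>_def)
  moreover have "x powr (\<nu> + 2) = x\<^sup>2 * x powr \<nu>"
    using x by (simp add: powr_add powr_numeral)
  ultimately have "(\<nu> + 2) * (g x - x * deriv g x) = x\<^sup>2 * ((\<nu> + 2) * x powr \<nu> * G x)" by simp
  thus ?thesis unfolding eq[OF x] by (simp add: a_def algebra_simps)
qed

lemma stationary_solution_proportional:
  fixes A \<gamma> \<nu> :: real
  assumes \<nu>: "-2 < \<nu>"
    and f: "stationary_solution (frag_rate A \<gamma>) (frag_kernel \<nu>) f"
    and g: "stationary_solution (frag_rate A \<gamma>) (frag_kernel \<nu>) g"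
    and pos: "\<And>x. x > 0 \<Longrightarrow> f x > 0"
  obtains c where "\<And>x. x \<ge> 0 \<Longrightarrow> g x = c * f x"
proof -
  have D: "(u has_real_derivative deriv u y) (at y)"
      "(deriv u has_real_derivative deriv (deriv u) y) (at y)"
    if "y > 0" "stationary_solution (frag_rate A \<gamma>) (frag_kernel \<nu>) u" for y u
  proof -
    have "(deriv ^^ 0) u field_differentiable at y" "(deriv ^^ 1) u field_differentiable at y"
      using that unfolding stationary_solution_def by blast+
    thus "(u has_real_derivative deriv u y) (at y)"
      "(deriv u has_real_derivative deriv (deriv u) y) (at y)"
      by (auto simp: field_differentiable_derivI)
  qed
  \<comment> \<open>The Wronskian divided by \<open>x powr (\<nu> + 2)\<close>, the growth that
    Abel's formula predicts from the first-order coefficient of the local equation.\<close>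
  define w where "w x = x powr (- \<nu> - 2) * (f x * deriv g x - deriv f x * g x)" for x
  have shift: "x powr (- \<nu> - 2) = x powr (- \<nu> - 3) * x" if "x > 0" for x
  proof -
    have "x powr (- \<nu> - 2) = x powr ((- \<nu> - 3) + 1)"
      by (rule arg_cong[where f = "\<lambda>t. x powr t"]) simp
    also have "\<dots> = x powr (- \<nu> - 3) * x powr 1" by (rule powr_add)
    finally show ?thesis using that by simp
  qed
  have "(w has_real_derivative 0) (at x)" if x: "x > 0" for x
  proof -
    have "(w has_real_derivative (- \<nu> - 2) * x powr (- \<nu> - 3) * (f x * deriv g x - deriv f x * g x)
        + x powr (- \<nu> - 2) * (f x * deriv (deriv g) x - deriv (deriv f) x * g x)) (at x)"
      unfolding w_def using x
      by (auto intro!: derivative_eq_intros D f g simp: algebra_simps)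
    also note shift[OF x]
    also have "(- \<nu> - 2) * x powr (- \<nu> - 3) * (f x * deriv g x - deriv f x * g x)
        + x powr (- \<nu> - 3) * x * (f x * deriv (deriv g) x - deriv (deriv f) x * g x)
      = x powr (- \<nu> - 3) / x * (f x * (x\<^sup>2 * deriv (deriv g) x) - (x\<^sup>2 * deriv (deriv f) x) * g x
        - (\<nu> + 2) * x * (f x * deriv g x - deriv f x * g x))"
      using x by (simp add: power2_eq_square field_simps)
    \<comment> \<open>After substitution of the local equation all products \<open>f x * g x\<close>
      cancel, and what is left is the subtracted multiple of the Wronskian.\<close>
    also have "f x * (x\<^sup>2 * deriv (deriv g) x) - (x\<^sup>2 * deriv (deriv f) x) * g x
        - (\<nu> + 2) * x * (f x * deriv g x - deriv f x * g x) = 0"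
      unfolding stationary_solution_ode[OF \<nu> f x] stationary_solution_ode[OF \<nu> g x]
      by (simp add: algebra_simps)
    finally show ?thesis by simp
  qed
  hence "\<exists>c. \<forall>y\<in>{0<..}. w y = c"
    by (intro has_field_derivative_zero_constant) (auto intro: has_field_derivative_at_within)
  then obtain c where c: "\<And>y. y > 0 \<Longrightarrow> w y = c" by auto
  \<comment> \<open>Each derivative is paired with a factor \<open>x\<close> to match the conditions
    at infinity; the exponent \<open>- \<nu> - 3\<close> that remains is negative.\<close>
  have "((\<lambda>x. x powr (- \<nu> - 3) * (f x * (x * deriv g x) - (x * deriv f x) * g x))
      \<longlongrightarrow> 0 * (0 * 0 - 0 * 0)) at_top" (is "(?v \<longlongrightarrow> _) _")
  proof (intro tendsto_mult tendsto_diff)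
    show "((\<lambda>x. x powr (- \<nu> - 3)) \<longlongrightarrow> 0) at_top"
      using \<nu> by (intro tendsto_neg_powr filterlim_ident) simp
  qed (use f g in \<open>simp_all add: stationary_solution_def\<close>)
  moreover have "\<forall>\<^sub>F x in at_top. ?v x = c"
    using eventually_gt_at_top[of 0]
  proof eventually_elim
    case (elim x)
    have "x powr (- \<nu> - 3) * (f x * (x * deriv g x) - (x * deriv f x) * g x)
        = x powr (- \<nu> - 3) * x * (f x * deriv g x - deriv f x * g x)"
      by (simp add: algebra_simps)
    also have "\<dots> = c" using c[OF elim] by (simp only: w_def shift[OF elim])
    finally show ?case .
  qed
  ultimately have "c = 0"
    using tendsto_unique[of at_top ?v] tendsto_eventually[of ?v c at_top] by fastforce
  hence W: "f x * deriv g x - deriv f x * g x = 0" if "x > 0" for x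
    using c[OF that] that by (simp add: w_def)
  \<comment> \<open>The quotient rule has the Wronskian as its numerator; positivity of
    \<open>f\<close> permits the division.\<close>
  have "((\<lambda>x. g x / f x) has_real_derivative 0) (at x)" if x: "x > 0" for x
  proof (rule DERIV_cong)
    show "((\<lambda>x. g x / f x) has_real_derivative (deriv g x * f x - g x * deriv f x) / (f x * f x)) (at x)"
      by (rule DERIV_divide) (use x pos[OF x] D f g in auto)
    show "(deriv g x * f x - g x * deriv f x) / (f x * f x) = 0"
      using W[OF x] by (simp add: algebra_simps)
  qed
  hence "\<exists>c. \<forall>y\<in>{0<..}. g y / f y = c"
    by (intro has_field_derivative_zero_constant) (auto intro: has_field_derivative_at_within)
  then obtain d where d: "\<And>y. y > 0 \<Longrightarrow> g y / f y = d" by auto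
  show ?thesis
  proof (rule that)
    fix x :: real assume "x \<ge> 0"
    moreover have "g 0 = 0" "f 0 = 0" using f g by (auto simp: stationary_solution_def)
    ultimately show "g x = d * f x"
      using d[of x] pos[of x] by (cases "x = 0") (auto simp: field_simps)
  qed
qed

section \<open>Smoothness and weighted integrability\<close>

text \<open>By induction each iterated derivative agrees on \<open>S\<close> with a member of
  \<open>P\<close>. Outside \<open>S\<close> the values of \<open>deriv\<close> are not controlled,
  so agreement is claimed on \<open>S\<close> only; openness of \<open>S\<close> suffices to
  transfer derivatives.\<close>

lemma iterated_deriv_field_differentiable:
  fixes f :: "'a::real_normed_field \<Rightarrow> 'a"
  assumes closed: "\<And>h. P h \<Longrightarrow> \<exists>h'. P h' \<and> (\<forall>x\<in>S. (h has_field_derivative h' x) (at x))"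
    and f: "P f" and S: "open S" "x \<in> S"
  shows "(deriv ^^ n) f field_differentiable at x"
proof -
  have step: "((deriv ^^ n) f has_field_derivative h' x) (at x)"
    if "\<forall>x\<in>S. (deriv ^^ n) f x = h x" "\<forall>x\<in>S. (h has_field_derivative h' x) (at x)" "x \<in> S" for n h h' x
  proof (rule has_field_derivative_transform_within_open)
    show "(h has_field_derivative h' x) (at x)" using that(2,3) by blast
    show "h y = (deriv ^^ n) f y" if "y \<in> S" for y
      using bspec[OF \<open>\<forall>x\<in>S. (deriv ^^ n) f x = h x\<close> that] by (rule sym)
  qed (use that S in simp_all)
  have "\<exists>h. P h \<and> (\<forall>x\<in>S. (deriv ^^ n) f x = h x)"
  proof (induction n)
    case 0
    show ?case by (intro exI[of _ f]) (simp add: f)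
  next
    case (Suc n)
    then obtain h where h: "P h" "\<forall>x\<in>S. (deriv ^^ n) f x = h x" by blast
    from closed[OF h(1)] obtain h' where
      h': "P h'" "\<forall>x\<in>S. (h has_field_derivative h' x) (at x)" by blast
    have "\<forall>x\<in>S. (deriv ^^ Suc n) f x = h' x"
      using step[OF h(2) h'(2)] by (simp add: DERIV_imp_deriv)
    with h'(1) show ?case by blast
  qed
  then obtain h where h: "P h" "\<forall>x\<in>S. (deriv ^^ n) f x = h x" by blast
  from closed[OF h(1)] obtain h' where "\<forall>x\<in>S. (h has_field_derivative h' x) (at x)" by blast
  from step[OF h(2) this S(2)] show ?thesis by (auto simp: field_differentiable_def)
qed

lemma in_X_add: "in_X m f \<Longrightarrow> in_X m g \<Longrightarrow> in_X m (\<lambda>x. f x + g x)"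
  unfolding in_X_def by (simp add: distrib_left set_integral_add)

lemma in_X_cmult: "in_X m f \<Longrightarrow> in_X m (\<lambda>x. c * f x)"
  unfolding in_X_def using set_integrable_mult_right[of c lborel "{0<..}" "\<lambda>x. x powr m * f x"]
  by (simp add: mult.left_commute)

lemma in_X_cong: "(\<And>x. x > 0 \<Longrightarrow> f x = g x) \<Longrightarrow> in_X m f = in_X m g"
  unfolding in_X_def by (intro set_integrable_cong) auto

section \<open>Powers times Bessel moments\<close>

locale fragmentation_parameters =
  fixes A \<gamma> \<nu> :: real
  assumes A_pos: "A > 0" and \<gamma>_nonneg: "\<gamma> \<ge> 0" and \<nu>_gt: "-2 < \<nu>"
begin

text \<open>The data of the substitution: the order of the Bessel function, the coefficient and the
  exponent of its argument \<open>\<beta> * x powr \<sigma>\<close>, and the exponent of the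
  prefactor.\<close>

definition "\<rho> = \<bar>\<nu> + 1\<bar> / (\<gamma> + 2)"
definition "\<beta> = 2 * sqrt A / (\<gamma> + 2)"
definition "\<sigma> = (\<gamma> + 2) / 2"
definition "\<alpha> = (\<nu> + 3) / 2"

text \<open>Differentiation either lowers the power or raises the moment index with a shift of the
  power, so two indices keep all derivatives among sums of such terms.\<close>

definition bterm :: "nat \<Rightarrow> real \<Rightarrow> real \<Rightarrow> real" where
  "bterm k r x = x powr r * bessel_moment \<rho> k (\<beta> * x powr \<sigma>)"

lemma \<rho>_nonneg: "\<rho> \<ge> 0" and \<beta>_pos: "\<beta> > 0" and \<sigma>_pos: "\<sigma> > 0" and \<beta>\<sigma>: "\<beta> * \<sigma> = sqrt A"
  using A_pos \<gamma>_nonneg by (auto simp: \<rho>_def \<beta>_def \<sigma>_def)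

lemma \<sigma>\<rho>: "\<sigma> * \<rho> = \<bar>\<nu> + 1\<bar> / 2"
proof -
  define g where "g = \<gamma> + 2"
  have "g \<noteq> 0" using \<gamma>_nonneg by (simp add: g_def)
  thus ?thesis unfolding \<sigma>_def \<rho>_def g_def[symmetric] by simp
qed

text \<open>The left-hand side is \<open>min 1 (\<nu> + 2)\<close>, the order of vanishing of the solution at the origin
  (up to a logarithm if \<open>\<nu> = -1\<close>).\<close>

lemma exponent_gap: "\<alpha> - \<sigma> * \<rho> > 0"
  using \<nu>_gt unfolding \<sigma>\<rho> \<alpha>_def by (auto simp: abs_if field_simps)

lemma bterm_pos: "x > 0 \<Longrightarrow> bterm k r x > 0"
  unfolding bterm_def using \<beta>_pos by (intro mult_pos_pos bessel_moment_pos) auto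

lemma bterm_nonneg: "x > 0 \<Longrightarrow> bterm k r x \<ge> 0"
  using bterm_pos less_imp_le by blast

lemma powr_mult_bterm: "x powr m * bterm k r x = bterm k (r + m) x"
  by (simp add: bterm_def powr_add)

lemma DERIV_bterm:
  assumes x: "x > 0"
  shows "(bterm k r has_real_derivative
    r * bterm k (r - 1) x - sqrt A * bterm (Suc k) (r + \<sigma> - 1) x) (at x)"
proof -
  have "((\<lambda>x. \<beta> * x powr \<sigma>) has_real_derivative \<beta> * (\<sigma> * x powr (\<sigma> - 1))) (at x)"
    using x by (auto intro!: derivative_eq_intros)
  moreover have "\<beta> * x powr \<sigma> > 0" using \<beta>_pos x by simp
  ultimately have "((\<lambda>x. bessel_moment \<rho> k (\<beta> * x powr \<sigma>)) has_real_derivative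
      - bessel_moment \<rho> (Suc k) (\<beta> * x powr \<sigma>) * (\<beta> * (\<sigma> * x powr (\<sigma> - 1)))) (at x)"
    by (intro DERIV_chain2[OF DERIV_bessel_moment])
  from DERIV_mult[OF has_real_derivative_powr[OF x, of r] this]
  have "(bterm k r has_real_derivative r * x powr (r - 1) * bessel_moment \<rho> k (\<beta> * x powr \<sigma>)
      + - bessel_moment \<rho> (Suc k) (\<beta> * x powr \<sigma>) * (\<beta> * (\<sigma> * x powr (\<sigma> - 1))) * x powr r) (at x)"
    by (simp add: bterm_def[abs_def])
  moreover have "x powr (r + \<sigma> - 1) = x powr (\<sigma> - 1) * x powr r"
    by (simp add: algebra_simps flip: powr_add)
  ultimately show ?thesis
    by (simp add: bterm_def algebra_simps flip: \<beta>\<sigma>)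
qed

lemma continuous_on_bterm: "continuous_on {0<..} (bterm k r)"
  by (intro continuous_at_imp_continuous_on ballI) (rule DERIV_isCont[OF DERIV_bterm], simp)

text \<open>The number \<open>r - \<sigma> * (\<rho> + real k)\<close> governs the behaviour at the
  origin. Every smaller exponent gives a bound on the whole half-line, because the moment decays
  faster than any power at infinity.\<close>

lemma bterm_le_powr:
  assumes q: "q < r - \<sigma> * (\<rho> + real k)"
  shows "\<exists>C. \<forall>x>0. bterm k r x \<le> C * x powr q"
proof -
  \<comment> \<open>Chosen to satisfy \<open>r - \<sigma> * p = q\<close>.\<close>
  define p where "p = (r - q) / \<sigma>"
  have "p > \<bar>\<rho>\<bar> + real k" using q \<sigma>_pos \<rho>_nonneg by (simp add: p_def field_simps)
  then obtain C where C: "\<And>x. x > 0 \<Longrightarrow> bessel_moment \<rho> k x \<le> C * x powr (- p)"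
    using bessel_moment_le_powr by blast
  show ?thesis
  proof (intro exI allI impI)
    fix x :: real assume x: "x > 0"
    have \<sigma>p: "\<sigma> * - p = q - r" using \<sigma>_pos by (simp add: p_def)
    have "bterm k r x \<le> x powr r * (C * (\<beta> * x powr \<sigma>) powr (- p))"
      unfolding bterm_def using x \<beta>_pos by (intro mult_left_mono C) auto
    also have "\<dots> = C * \<beta> powr (- p) * (x powr r * x powr (\<sigma> * - p))"
      using x \<beta>_pos by (simp add: powr_mult powr_powr)
    also have "x powr r * x powr (\<sigma> * - p) = x powr q"
      unfolding \<sigma>p by (simp flip: powr_add)
    finally show "bterm k r x \<le> C * \<beta> powr (- p) * x powr q" .
  qed
qed

lemma set_integrable_bterm:
  assumes "r - \<sigma> * (\<rho> + real k) > -1"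
  shows "set_integrable lborel {0<..} (bterm k r)"
proof -
  \<comment> \<open>Half the distance to the critical exponent -1, so that
    \<open>\<epsilon> - 1\<close> and \<open>- \<epsilon> - 1\<close> both stay strictly below
    \<open>r - \<sigma> * (\<rho> + real k)\<close>.\<close>
  define \<epsilon> where "\<epsilon> = (r - \<sigma> * (\<rho> + real k) + 1) / 2"
  have \<epsilon>: "\<epsilon> > 0" "\<epsilon> - 1 < r - \<sigma> * (\<rho> + real k)" "- \<epsilon> - 1 < r - \<sigma> * (\<rho> + real k)"
    using assms by (simp_all add: \<epsilon>_def field_simps)
  obtain C where C: "\<And>x. x > 0 \<Longrightarrow> bterm k r x \<le> C * x powr (\<epsilon> - 1)"
    using bterm_le_powr[OF \<epsilon>(2)] by blast
  obtain D where D: "\<And>x. x > 0 \<Longrightarrow> bterm k r x \<le> D * x powr (- \<epsilon> - 1)"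
    using bterm_le_powr[OF \<epsilon>(3)] by blast
  show ?thesis
    by (rule set_integrable_powr_bounds[OF \<epsilon>(1) continuous_on_bterm, of k r C D])
       (simp_all add: C D bterm_nonneg)
qed

lemma bterm_tendsto_0_at_top: "(bterm k r \<longlongrightarrow> 0) at_top"
proof -
  \<comment> \<open>The subtraction of 1 makes \<open>q\<close> negative and strictly admissible for
    the power bound.\<close>
  define q where "q = min 0 (r - \<sigma> * (\<rho> + real k)) - 1"
  have q: "q < 0" "q < r - \<sigma> * (\<rho> + real k)" by (auto simp: q_def)
  obtain C where C: "\<And>x. x > 0 \<Longrightarrow> bterm k r x \<le> C * x powr q"
    using bterm_le_powr[OF q(2)] by blast
  show ?thesis
  proof (rule Lim_null_comparison)
    show "\<forall>\<^sub>F x in at_top. norm (bterm k r x) \<le> C * x powr q"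
      using eventually_gt_at_top[of 0] by eventually_elim (simp add: C bterm_nonneg)
    show "((\<lambda>x. C * x powr q) \<longlongrightarrow> 0) at_top"
      by (intro tendsto_mult_right_zero tendsto_neg_powr q(1) filterlim_ident)
  qed
qed

lemma bterm_tendsto_0_at_right:
  assumes "r - \<sigma> * (\<rho> + real k) > 0"
  shows "(bterm k r \<longlongrightarrow> 0) (at_right 0)"
proof -
  define q where "q = (r - \<sigma> * (\<rho> + real k)) / 2"
  have q: "q > 0" "q < r - \<sigma> * (\<rho> + real k)" using assms by (auto simp: q_def)
  obtain C where C: "\<And>x. x > 0 \<Longrightarrow> bterm k r x \<le> C * x powr q"
    using bterm_le_powr[OF q(2)] by blast
  show ?thesis
  proof (rule Lim_null_comparison)
    show "\<forall>\<^sub>F x in at_right 0. norm (bterm k r x) \<le> C * x powr q"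
      using eventually_at_right_less[of 0] by eventually_elim (simp add: C bterm_nonneg)
    have "((\<lambda>x. x powr q) \<longlongrightarrow> 0) (at_right 0)" using q(1) by real_asymp
    thus "((\<lambda>x. C * x powr q) \<longlongrightarrow> 0) (at_right 0)" by (rule tendsto_mult_right_zero)
  qed
qed

text \<open>This span is closed under differentiation, which gives smoothness.\<close>

inductive bspan :: "(real \<Rightarrow> real) \<Rightarrow> bool" where
  bterm: "bspan (bterm k r)"
| add: "bspan g \<Longrightarrow> bspan h \<Longrightarrow> bspan (\<lambda>x. g x + h x)"
| scale: "bspan h \<Longrightarrow> bspan (\<lambda>x. c * h x)"

lemma bspan_DERIV:
  assumes "bspan h"
  shows "\<exists>h'. bspan h' \<and> (\<forall>x\<in>{0<..}. (h has_real_derivative h' x) (at x))"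
  using assms
proof induction
  case (bterm k r)
  have "bspan (\<lambda>x. r * bterm k (r - 1) x + - sqrt A * bterm (Suc k) (r + \<sigma> - 1) x)"
    by (intro bspan.intros)
  moreover have "\<forall>x\<in>{0<..}. (bterm k r has_real_derivative
      r * bterm k (r - 1) x + - sqrt A * bterm (Suc k) (r + \<sigma> - 1) x) (at x)"
    using DERIV_bterm[of _ k r] by simp
  ultimately show ?case by blast
next
  case (add g h)
  then obtain g' h' where *: "bspan g'" "bspan h'"
    "\<forall>x\<in>{0<..}. (g has_real_derivative g' x) (at x)" "\<forall>x\<in>{0<..}. (h has_real_derivative h' x) (at x)"
    by blast
  have "\<forall>x\<in>{0<..}. ((\<lambda>x. g x + h x) has_real_derivative g' x + h' x) (at x)"
    using * DERIV_add by blast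
  with bspan.add[OF *(1,2)] show ?case by blast
next
  case (scale h c)
  then obtain h' where *: "bspan h'" "\<forall>x\<in>{0<..}. (h has_real_derivative h' x) (at x)"
    by blast
  have "\<forall>x\<in>{0<..}. ((\<lambda>x. c * h x) has_real_derivative c * h' x) (at x)"
    using * DERIV_cmult by blast
  with bspan.scale[OF *(1)] show ?case by blast
qed

section \<open>The Bessel profile and its equations\<close>

definition "profile = bterm 0 \<alpha>"
text \<open>The derivatives are spelled out in terms of \<open>bterm\<close>, so that integrability
  and limits can be obtained termwise.\<close>

definition "profile' x = \<alpha> * bterm 0 (\<alpha> - 1) x - sqrt A * bterm 1 (\<alpha> + \<sigma> - 1) x"
definition "profile'' x = \<alpha> * (\<alpha> - 1) * bterm 0 (\<alpha> - 2) x
  - sqrt A * (2 * \<alpha> + \<sigma> - 1) * bterm 1 (\<alpha> + \<sigma> - 2) x + A * bterm 2 (\<alpha> + 2 * \<sigma> - 2) x"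

lemma DERIV_profile: "x > 0 \<Longrightarrow> (profile has_real_derivative profile' x) (at x)"
  using DERIV_bterm[of x 0 \<alpha>] by (simp add: profile_def profile'_def)

lemma DERIV_profile':
  assumes x: "x > 0"
  shows "(profile' has_real_derivative profile'' x) (at x)"
proof -
  have D: "(profile' has_real_derivative
      \<alpha> * ((\<alpha> - 1) * bterm 0 (\<alpha> - 1 - 1) x - sqrt A * bterm (Suc 0) (\<alpha> - 1 + \<sigma> - 1) x)
      - sqrt A * ((\<alpha> + \<sigma> - 1) * bterm 1 (\<alpha> + \<sigma> - 1 - 1) x
        - sqrt A * bterm (Suc 1) (\<alpha> + \<sigma> - 1 + \<sigma> - 1) x)) (at x)"
    unfolding profile'_def[abs_def]
    by (intro DERIV_diff DERIV_cmult DERIV_bterm x)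
  have eqs: "\<alpha> - 1 - 1 = \<alpha> - 2" "\<alpha> - 1 + \<sigma> - 1 = \<alpha> + \<sigma> - 2" "\<alpha> + \<sigma> - 1 - 1 = \<alpha> + \<sigma> - 2"
    "\<alpha> + \<sigma> - 1 + \<sigma> - 1 = \<alpha> + 2 * \<sigma> - 2" by simp_all
  have collect: "\<alpha> * ((\<alpha> - 1) * a - s * b) - s * ((\<alpha> + \<sigma> - 1) * b - s * c)
      = \<alpha> * (\<alpha> - 1) * a - s * (2 * \<alpha> + \<sigma> - 1) * b + (s * s) * c" for a b c s
    by (simp add: algebra_simps)
  have sqrt_A: "sqrt A * sqrt A = A" using A_pos by simp
  show ?thesis
    using D unfolding eqs collect sqrt_A profile''_def One_nat_def numeral_2_eq_2 .
qed

lemma profile_ode: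
  assumes x: "x > 0"
  shows "x\<^sup>2 * profile'' x = (\<nu> + 2) * (x * profile' x - profile x) + A * x powr (\<gamma> + 2) * profile x"
proof -
  define M where "M k = bessel_moment \<rho> k (\<beta> * x powr \<sigma>)" for k
  define z where "z = \<beta> * x powr \<sigma>"
  have z: "z > 0" using x \<beta>_pos by (simp add: z_def)
  \<comment> \<open>The modified Bessel equation in terms of moments, used to eliminate
    \<open>M 2\<close>.\<close>
  have rec: "z\<^sup>2 * M 2 = z * M 1 + (z\<^sup>2 + \<rho>\<^sup>2) * M 0"
    using bessel_moment_recurrence[OF z, of \<rho>] by (simp add: M_def z_def)
  have \<sigma>z: "\<sigma> * z = sqrt A * x powr \<sigma>" by (simp add: z_def flip: \<beta>\<sigma>)
  hence \<sigma>z2: "\<sigma>\<^sup>2 * z\<^sup>2 = A * x powr (\<gamma> + 2)"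
  proof -
    have "\<sigma>\<^sup>2 * z\<^sup>2 = (sqrt A * x powr \<sigma>)\<^sup>2" by (simp flip: \<sigma>z power_mult_distrib)
    also have "\<dots> = (sqrt A)\<^sup>2 * (x powr \<sigma> * x powr \<sigma>)"
      by (simp only: power_mult_distrib power2_eq_square[of "x powr \<sigma>"])
    also have "\<dots> = A * x powr (\<sigma> + \<sigma>)"
      using A_pos by (simp only: powr_add real_sqrt_pow2 less_imp_le)
    also have "\<sigma> + \<sigma> = \<gamma> + 2" by (simp add: \<sigma>_def)
    finally show ?thesis .
  qed
  have \<sigma>2: "2 * \<sigma> = \<gamma> + 2" by (simp add: \<sigma>_def)
  have e: "x\<^sup>2 * x powr (\<alpha> - 2) = x powr \<alpha>" "x * x powr (\<alpha> - 1) = x powr \<alpha>"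
    "x\<^sup>2 * x powr (\<alpha> + \<sigma> - 2) = x powr \<alpha> * x powr \<sigma>"
    "x * x powr (\<alpha> + \<sigma> - 1) = x powr \<alpha> * x powr \<sigma>"
    "x\<^sup>2 * x powr (\<alpha> + 2 * \<sigma> - 2) = x powr \<alpha> * x powr (\<gamma> + 2)"
    using x \<sigma>2 by (simp_all add: powr_add powr_diff powr_numeral)
  have P: "profile x = x powr \<alpha> * M 0"
    by (simp add: profile_def bterm_def M_def)
  have "x * profile' x = \<alpha> * (x * x powr (\<alpha> - 1)) * M 0 - sqrt A * (x * x powr (\<alpha> + \<sigma> - 1)) * M 1"
    by (simp add: profile'_def bterm_def M_def algebra_simps)
  also have "\<dots> = x powr \<alpha> * (\<alpha> * M 0 - \<sigma> * z * M 1)"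
    unfolding e \<sigma>z by (simp add: algebra_simps)
  finally have P': "x * profile' x = x powr \<alpha> * (\<alpha> * M 0 - \<sigma> * z * M 1)" .
  have "x\<^sup>2 * profile'' x = \<alpha> * (\<alpha> - 1) * (x\<^sup>2 * x powr (\<alpha> - 2)) * M 0
      - sqrt A * (2 * \<alpha> + \<sigma> - 1) * (x\<^sup>2 * x powr (\<alpha> + \<sigma> - 2)) * M 1
      + A * (x\<^sup>2 * x powr (\<alpha> + 2 * \<sigma> - 2)) * M 2"
    by (simp add: profile''_def bterm_def M_def algebra_simps)
  also have "\<dots> = x powr \<alpha> * (\<alpha> * (\<alpha> - 1) * M 0 - (2 * \<alpha> + \<sigma> - 1) * (sqrt A * x powr \<sigma>) * M 1
      + (A * x powr (\<gamma> + 2)) * M 2)"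
    unfolding e by (simp add: algebra_simps)
  also have "\<dots> = x powr \<alpha> * (\<alpha> * (\<alpha> - 1) * M 0 - (2 * \<alpha> + \<sigma> - 1) * (\<sigma> * z) * M 1
      + \<sigma>\<^sup>2 * (z\<^sup>2 * M 2))"
    by (simp flip: \<sigma>z \<sigma>z2)
  \<comment> \<open>The summand \<open>z * M 1\<close> of the recurrence removes
    \<open>\<sigma>\<close> from the coefficient \<open>2 * \<alpha> + \<sigma> - 1\<close>, and the
    summand with \<open>\<rho>\<close> adds \<open>(\<sigma> * \<rho>)\<^sup>2\<close> to the
    coefficient of \<open>M 0\<close>.\<close>
  also have "\<dots> = x powr \<alpha> * ((\<alpha> * (\<alpha> - 1) + (\<sigma> * \<rho>)\<^sup>2) * M 0 - (2 * \<alpha> - 1) * (\<sigma> * z) * M 1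
      + (\<sigma>\<^sup>2 * z\<^sup>2) * M 0)"
    unfolding rec by (simp add: algebra_simps power2_eq_square)
  \<comment> \<open>Here the choices of \<open>\<alpha>\<close> and \<open>\<rho>\<close> take
    effect: the coefficients become those of
    \<open>(\<nu> + 2) * (x * profile' x - profile x)\<close>.\<close>
  also have "\<alpha> * (\<alpha> - 1) + (\<sigma> * \<rho>)\<^sup>2 = (\<nu> + 2) * (\<alpha> - 1)"
    unfolding \<sigma>\<rho> \<alpha>_def by (simp add: power_divide power2_eq_square field_simps)
  also have "2 * \<alpha> - 1 = \<nu> + 2" by (simp add: \<alpha>_def)
  finally show ?thesis unfolding P P' \<sigma>z2 by (simp add: algebra_simps)
qed

lemma profile_pos: "x > 0 \<Longrightarrow> profile x > 0"
  by (simp add: profile_def bterm_pos)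

lemma profile_integral_equation:
  assumes x: "x > 0"
  shows "(LBINT y:{x<..}. frag_rate A \<gamma> y * frag_kernel \<nu> x y * profile y)
    = - profile'' x + frag_rate A \<gamma> x * profile x"
proof -
  \<comment> \<open>The value that the tail integral of \<open>h\<close> must have, found by setting
    the first integral of the nonlocal equation to zero. By the local equation \<open>- Q\<close> is
    an antiderivative of \<open>h\<close>.\<close>
  define Q where "Q y = y powr (- \<nu> - 2) * (profile y - y * profile' y)" for y
  define h where "h y = A * y powr (\<gamma> - \<nu> - 1) * profile y" for y
  have "(LBINT y:{x<..}. h y) = 0 - (- Q x)"
  proof (rule FTC_greaterThan_nonneg)
    fix y assume "x < y"
    hence y: "y > 0" using x by simp
    show "0 \<le> h y" using A_pos profile_pos[OF y] by (simp add: h_def)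
    show "isCont h y"
      unfolding h_def using y by (intro continuous_intros DERIV_isCont[OF DERIV_profile]) auto
    show "((\<lambda>y. - Q y) has_real_derivative h y) (at y)"
    proof (rule DERIV_cong)
      show "((\<lambda>y. - Q y) has_real_derivative
          - ((- \<nu> - 2) * y powr (- \<nu> - 3) * (profile y - y * profile' y)
            + y powr (- \<nu> - 2) * (- y * profile'' y))) (at y)"
        unfolding Q_def using y
        by (auto intro!: derivative_eq_intros DERIV_profile DERIV_profile' simp: algebra_simps)
      have "y powr (- \<nu> - 2) = y powr (- \<nu> - 3) * y"
        and e: "y powr (\<gamma> - \<nu> - 1) = y powr (- \<nu> - 3) * y powr (\<gamma> + 2)"
        using y by (simp_all add: powr_diff powr_add powr_minus powr_numeral field_simps power_numeral_reduce)
      hence "- ((- \<nu> - 2) * y powr (- \<nu> - 3) * (profile y - y * profile' y)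
            + y powr (- \<nu> - 2) * (- y * profile'' y))
          = y powr (- \<nu> - 3) * ((\<nu> + 2) * (profile y - y * profile' y) + y\<^sup>2 * profile'' y)"
        by (simp only:) (simp add: algebra_simps power2_eq_square)
      also have "\<dots> = h y"
        unfolding profile_ode[OF y] h_def e by (simp add: algebra_simps)
      finally show "- ((- \<nu> - 2) * y powr (- \<nu> - 3) * (profile y - y * profile' y)
            + y powr (- \<nu> - 2) * (- y * profile'' y)) = h y" .
    qed
  next
    have "isCont Q x"
      unfolding Q_def using x
      by (intro continuous_intros DERIV_isCont[OF DERIV_profile] DERIV_isCont[OF DERIV_profile']) auto
    thus "((\<lambda>y. - Q y) \<longlongrightarrow> - Q x) (at_right x)"
      by (intro tendsto_intros) (simp add: isCont_def filterlim_at_split)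
  next
    \<comment> \<open>On the positive half-line \<open>- Q\<close> is a combination of two
      \<open>bterm\<close> values, which vanish at infinity whatever their powers.\<close>
    have "((\<lambda>y. (\<alpha> - 1) * bterm 0 (\<alpha> - \<nu> - 2) y - sqrt A * bterm 1 (\<alpha> + \<sigma> - \<nu> - 2) y)
        \<longlongrightarrow> (\<alpha> - 1) * 0 - sqrt A * 0) at_top"
      by (intro tendsto_intros bterm_tendsto_0_at_top)
    moreover have "\<forall>\<^sub>F y in at_top.
        (\<alpha> - 1) * bterm 0 (\<alpha> - \<nu> - 2) y - sqrt A * bterm 1 (\<alpha> + \<sigma> - \<nu> - 2) y = - Q y"
      using eventually_gt_at_top[of 0]
      by eventually_elim
         (simp add: Q_def profile_def profile'_def bterm_def powr_add powr_diff powr_minus powr_numeral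
            field_simps power2_eq_square)
    ultimately show "((\<lambda>y. - Q y) \<longlongrightarrow> 0) at_top"
      using Lim_transform_eventually by fastforce
  qed
  have "(LBINT y:{x<..}. frag_rate A \<gamma> y * frag_kernel \<nu> x y * profile y)
      = (LBINT y:{x<..}. (\<nu> + 2) * x powr \<nu> * h y)"
    using x by (intro set_lebesgue_integral_cong)
      (auto simp: frag_rate_def frag_kernel_def h_def powr_diff powr_add field_simps)
  also have "\<dots> = (\<nu> + 2) * (x powr \<nu> * Q x)"
    using \<open>(LBINT y:{x<..}. h y) = 0 - (- Q x)\<close> by simp
  also have "x powr \<nu> * Q x = (profile x - x * profile' x) / x\<^sup>2"
    using x by (simp add: Q_def powr_diff powr_minus powr_numeral field_simps)
  \<comment> \<open>This is the local equation divided by \<open>x\<^sup>2\<close>.\<close>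
  also have "(\<nu> + 2) * \<dots> = - profile'' x + A * x powr \<gamma> * profile x"
    using x profile_ode[OF x] by (simp add: powr_add powr_numeral field_simps)
  finally show ?thesis by (simp add: frag_rate_def)
qed

lemma in_X_bterm:
  assumes "r + m - \<sigma> * (\<rho> + real k) > -1"
  shows "in_X m (bterm k r)"
  unfolding in_X_def powr_mult_bterm by (rule set_integrable_bterm[OF assms])

lemma stationary_solution_profile:
  assumes "c \<ge> 0"
  shows "stationary_solution (frag_rate A \<gamma>) (frag_kernel \<nu>) (\<lambda>x. c * profile x)"
proof -
  let ?f = "\<lambda>x. c * profile x"
  have d1: "deriv ?f x = c * profile' x" if "x > 0" for x
    by (rule DERIV_imp_deriv) (intro DERIV_cmult DERIV_profile that)
  have d2: "(deriv ^^ 2) ?f x = c * profile'' x" if x: "x > 0" for x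
  proof -
    have "(deriv ?f has_real_derivative c * profile'' x) (at x)"
      by (rule has_field_derivative_transform_within_open[where S = "{0<..}" and f = "\<lambda>x. c * profile' x"])
         (use x d1 DERIV_cmult[OF DERIV_profile'[OF x]] in auto)
    thus ?thesis by (simp add: numeral_2_eq_2 DERIV_imp_deriv)
  qed
  \<comment> \<open>The convention that \<open>0 powr \<alpha>\<close> is 0 supplies the boundary
    value; it agrees with the right limit, which gives continuity at the origin.\<close>
  have f0: "profile 0 = 0" by (simp add: profile_def bterm_def)
  have "in_X m profile" if "m > -1" for m
    unfolding profile_def using that exponent_gap by (intro in_X_bterm) simp
  hence X: "in_X m ?f" if "m > -1" for m
    using that in_X_cmult by blast
  have Xa: "in_X m (\<lambda>x. frag_rate A \<gamma> x * ?f x)" if "m > -1" for m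
  proof -
    have "in_X m (\<lambda>x. A * c * bterm 0 (\<alpha> + \<gamma>) x)"
      using that exponent_gap \<gamma>_nonneg by (intro in_X_cmult in_X_bterm) simp
    thus ?thesis
      by (simp add: frag_rate_def profile_def mult_ac flip: powr_mult_bterm)
  qed
  \<comment> \<open>All three terms share the exponent
    \<open>\<alpha> - 2 - \<sigma> * \<rho>\<close> at the origin, since each increase of the moment
    index is compensated by \<open>\<sigma>\<close> in the power. By \<open>exponent_gap\<close>, a
    weight with \<open>m \<ge> 1\<close> lifts it above -1.\<close>
  have X2: "in_X m ((deriv ^^ 2) ?f)" if "m \<ge> 1" for m
  proof -
    have "in_X m (\<lambda>x. c * (\<alpha> * (\<alpha> - 1) * bterm 0 (\<alpha> - 2) x
        + (- sqrt A * (2 * \<alpha> + \<sigma> - 1)) * bterm 1 (\<alpha> + \<sigma> - 2) x + A * bterm 2 (\<alpha> + 2 * \<sigma> - 2) x))"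
      using that exponent_gap
      by (intro in_X_cmult in_X_add in_X_bterm) (auto simp: algebra_simps)
    thus ?thesis
      by (rule in_X_cong[THEN iffD1, rotated]) (simp add: d2 profile''_def)
  qed
  have "(profile \<longlongrightarrow> 0) (at 0 within {0..})"
    using bterm_tendsto_0_at_right[of \<alpha> 0] exponent_gap
    by (simp add: profile_def at_within_Ici_at_right)
  hence "continuous (at 0 within {0..}) profile" by (simp add: continuous_within f0)
  moreover have "continuous (at x within {0..}) profile" if "x > 0" for x
    using DERIV_isCont[OF DERIV_profile[OF that]] by (rule continuous_at_imp_continuous_at_within)
  ultimately have "continuous_on {0..} profile"
    unfolding continuous_on_eq_continuous_within by (metis atLeast_iff order_le_less)
  hence cont: "continuous_on {0..} ?f" by (intro continuous_intros)
  have smooth: "((deriv ^^ n) ?f) field_differentiable (at x)" if "x > 0" for n x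
    by (rule iterated_deriv_field_differentiable[where P = bspan and S = "{0<..}", OF bspan_DERIV])
       (use that bspan.scale[OF bspan.bterm, of c 0 \<alpha>] in \<open>auto simp: profile_def\<close>)
  have eq: "- (deriv ^^ 2) ?f x + frag_rate A \<gamma> x * ?f x =
      (LBINT y:{x<..}. frag_rate A \<gamma> y * frag_kernel \<nu> x y * ?f y)" if "x > 0" for x
  proof -
    have "(LBINT y:{x<..}. frag_rate A \<gamma> y * frag_kernel \<nu> x y * ?f y)
        = (LBINT y:{x<..}. c * (frag_rate A \<gamma> y * frag_kernel \<nu> x y * profile y))"
      by (simp add: mult_ac)
    also have "\<dots> = c * (- profile'' x + frag_rate A \<gamma> x * profile x)"
      by (simp only: set_integral_mult_right profile_integral_equation[OF that])
    finally show ?thesis by (simp add: d2 that algebra_simps)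
  qed
  have lim: "(?f \<longlongrightarrow> 0) at_top"
    unfolding profile_def using bterm_tendsto_0_at_top by (rule tendsto_mult_right_zero)
  have "((\<lambda>z. c * (\<alpha> * bterm 0 \<alpha> z - sqrt A * bterm 1 (\<alpha> + \<sigma>) z))
      \<longlongrightarrow> c * (\<alpha> * 0 - sqrt A * 0)) at_top"
    by (intro tendsto_intros bterm_tendsto_0_at_top)
  moreover have "\<forall>\<^sub>F z in at_top. c * (\<alpha> * bterm 0 \<alpha> z - sqrt A * bterm 1 (\<alpha> + \<sigma>) z) = z * deriv ?f z"
    using eventually_gt_at_top[of 0]
    by eventually_elim (simp add: d1 profile'_def bterm_def powr_diff field_simps)
  ultimately have lim': "((\<lambda>z. z * deriv ?f z) \<longlongrightarrow> 0) at_top"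
    using Lim_transform_eventually by fastforce
  have "0 \<le> ?f x" if "x \<ge> 0" for x
    using that assms profile_pos[of x] f0 by (cases "x = 0") auto
  thus ?thesis
    unfolding stationary_solution_def using cont smooth eq f0 X Xa X2 lim lim' by auto
qed

end

section \<open>Normalisation and the explicit formula\<close>

theorem proposition1p1:
  fixes A \<gamma> \<nu> :: real
  assumes "A > 0" and "\<gamma> \<ge> 0" and "-2 < \<nu>" and "\<nu> \<le> 0"
  shows "\<exists>f c.
    (stationary_solution (frag_rate A \<gamma>) (frag_kernel \<nu>) f \<and> (LBINT x:{0<..}. x * f x) = 1) \<and>
    (\<forall>g. stationary_solution (frag_rate A \<gamma>) (frag_kernel \<nu>) g \<and> (LBINT x:{0<..}. x * g x) = 1
           \<longrightarrow> (\<forall>x\<ge>0. g x = f x)) \<and>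
    (\<forall>z>0. f z = c * sqrt A * z powr ((\<nu> + 3) / 2) *
        bessel_K (\<bar>\<nu> + 1\<bar> / (\<gamma> + 2)) (2 * sqrt A / (\<gamma> + 2) * z powr ((\<gamma> + 2) / 2)))"
proof -
  interpret fragmentation_parameters A \<gamma> \<nu> by unfold_locales (use assms in auto)
  define I where "I = (LBINT x:{0<..}. x * profile x)"
  define f where "f x = 1 / I * profile x" for x
  have "set_integrable lborel {0<..} (bterm 0 (\<alpha> + 1))"
    using exponent_gap by (intro set_integrable_bterm) simp
  moreover have "x * profile x = bterm 0 (\<alpha> + 1) x" if "x > 0" for x
    using that by (simp add: profile_def flip: powr_mult_bterm)
  ultimately have "set_integrable lborel {0<..} (\<lambda>x. x * profile x)"
    by (subst set_integrable_cong[OF refl refl]) auto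
  hence I: "I > 0"
    unfolding I_def by (rule set_integral_greaterThan_pos) (simp add: profile_pos)
  have sol: "stationary_solution (frag_rate A \<gamma>) (frag_kernel \<nu>) f"
    unfolding f_def[abs_def] using I by (intro stationary_solution_profile) simp
  have "(LBINT x:{0<..}. x * f x) = (LBINT x:{0<..}. 1 / I * (x * profile x))"
    by (simp add: f_def mult_ac)
  also have "\<dots> = 1 / I * I" by (simp only: set_integral_mult_right I_def)
  finally have norm: "(LBINT x:{0<..}. x * f x) = 1" using I by simp
  have "g x = f x" if g: "stationary_solution (frag_rate A \<gamma>) (frag_kernel \<nu>) g"
    "(LBINT x:{0<..}. x * g x) = 1" and "x \<ge> 0" for g x
  proof -
    obtain c where c: "\<And>x. x \<ge> 0 \<Longrightarrow> g x = c * f x"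
      using stationary_solution_proportional[OF assms(3) sol g(1)] I profile_pos
      by (metis divide_pos_pos f_def mult_pos_pos zero_less_one)
    \<comment> \<open>Both functions have first moment 1, which forces the factor to be 1.\<close>
    have "1 = (LBINT x:{0<..}. c * (x * f x))"
      unfolding g(2)[symmetric] by (intro set_lebesgue_integral_cong) (auto simp: c)
    hence "c = 1" using norm by simp
    thus ?thesis using c \<open>x \<ge> 0\<close> by simp
  qed
  \<comment> \<open>The witness \<open>1 / (I * sqrt A)\<close> cancels the factor
    \<open>sqrt A\<close> of the formula; the moment of index 0 is the Bessel function
    itself.\<close>
  moreover have "f z = 1 / (I * sqrt A) * sqrt A * z powr ((\<nu> + 3) / 2) *
      bessel_K (\<bar>\<nu> + 1\<bar> / (\<gamma> + 2)) (2 * sqrt A / (\<gamma> + 2) * z powr ((\<gamma> + 2) / 2))" for z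
    using assms(1)
    by (simp add: f_def profile_def bterm_def bessel_K_eq_moment \<alpha>_def \<rho>_def \<beta>_def \<sigma>_def)
  ultimately show ?thesis using sol norm by blast
qed

end
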